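(* For the wsk-fractal time derivative $${}^{\mathrm{wsk}}\mathfrak D_F^\gamma f(S_F^\alpha(t))=\frac{\mathcal N(\gamma)}{1-\gamma}\int_a^t e^{-\frac{\gamma\,(S_F^\alpha(t)-S_F^\alpha(\tau))}{1-\gamma}}\,D_{F,\tau}^\alpha f(S_F^\alpha(\tau))\,d_F^\alpha\tau ,$$ where $\mathcal N(\gamma)$ is a normalization function such that $\mathcal N(0)=\mathcal N(1)=1$, we have $$\mathfrak L\left[{}^{\mathrm{wsk}}\mathfrak D_F^\gamma f\right](S_F^\alpha(v))=\frac{\mathcal N(\gamma)}{1-\gamma}\left\{\frac{S_F^\alpha(v)\,\mathfrak L[f](S_F^\alpha(v))-f(0)}{S_F^\alpha(v)+\frac{\gamma}{1-\gamma}}\right\}$$ and $$\mathscr S\left[{}^{\mathrm{wsk}}\mathfrak D_F^\gamma f\right](S_F^\alpha(v))=\frac{\mathcal N(\gamma)}{1-\gamma}\left\{\frac{\mathscr S[f](S_F^\alpha(v))-f(0)}{1+\frac{\gamma}{1-\gamma}S_F^\alpha(v)}\right\},$$ where $\mathfrak L$ and $\mathscr S$ denote the fractal Laplace and fractal Sumudu transforms.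
   Context: Let $0<\alpha\le1$ and let $F$ be a fractal subset of the real line. For a subdivision $\mathbb P=\{x=x_0,x_1,\dots,x_n=y\}$ of $[x,y]$, $x<y$, put $\sigma^\alpha[F,\mathbb P]=\sum_{i=0}^{n-1}\frac{(x_{i+1}-x_i)^\alpha}{\Gamma(\alpha+1)}\Theta(F,[x_i,x_{i+1}])$, where $\Theta(F,I)=1$ if $F\cap I\ne\emptyset$ and $0$ otherwise (and $\sigma^\alpha=0$ if $x=y$). Put $\gamma^\alpha(F,x,y)=\lim_{\delta\to0}\inf\sigma^\alpha[F,\mathbb P]$, the infimum being over subdivisions of $[x,y]$ of mesh at most $\delta$. For a fixed arbitrary real $l$, the integral staircase function is $S_F^\alpha(x)=\gamma^\alpha(F,l,x)$ if $x\ge l$ and $-\gamma^\alpha(F,x,l)$ otherwise. $D_F^\alpha$ and $\int\cdot\,d_F^\alpha$ are the derivative and integral of $F^\alpha$-calculus: for $x\in F$, $D_F^\alpha h(x)$ is the limit, along points $y\in F$, $y\to x$, of $\frac{h(y)-h(x)}{S_F^\alpha(y)-S_F^\alpha(x)}$ (if it exists), and $D_F^\alpha h(x)=0$ for $x\notin F$; $\int_a^b h\,d_F^\alpha t$ is the common value, if they agree, of the infimum of the upper sums and the supremum of the lower sums obtained by weighting the supremum, respectively infimum, of $h$ over $F\cap[x_i,x_{i+1}]$ (taken as $0$ if this set is empty) by $S_F^\alpha(x_{i+1})-S_F^\alpha(x_i)$. A subscript as in $D_{F,\tau}^\alpha$ indicates the variable. Here $\gamma\in[0,1)$ is the order and $f\in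 C_F^\alpha[a,b]$, $b>a$, where $C_F^\alpha[a,b]$ is the family of $\alpha$-order differentiable functions on $[a,b]$. The fractal Laplace transform of $g(S_F^\alpha(t))$, $t\ge0$, is $\mathfrak L[g](S_F^\alpha(v))=\int_0^\infty e^{-S_F^\alpha(v)S_F^\alpha(t)}g(S_F^\alpha(t))\,d_F^\alpha t$, if the integral exists. The fractal Sumudu transform is $\mathscr S[g](S_F^\alpha(v))=\frac{1}{S_F^\alpha(v)}\int_0^\infty e^{-S_F^\alpha(t)/S_F^\alpha(v)}g(S_F^\alpha(t))\,d_F^\alpha t$, if the integral exists.
   Formalization: Taken with a=0, f α-order differentiable on every [0,b], F closed with finite mass on bounded intervals, S_F^α(0)=0 and S_F^α(t)→∞; the formulas fail otherwise (e.g. bounded S_F^α, γ=0, f=1). The wsk integral and the transform of f are assumed to exist. *)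

theory Defs
  imports "HOL-Analysis.Analysis"
begin

text \<open>A subdivision \<open>a = x 0 < x 1 < \<dots> < x n = b\<close>; for \<open>a = b\<close> this forces \<open>n = 0\<close>,
  so that all sums over subdivisions of a degenerate interval vanish.\<close>

definition subdivision :: "real \<Rightarrow> real \<Rightarrow> nat \<Rightarrow> (nat \<Rightarrow> real) \<Rightarrow> bool" where
  "subdivision a b n x \<longleftrightarrow> x 0 = a \<and> x n = b \<and> (\<forall>i<n. x i < x (Suc i))"

definition flag :: "real set \<Rightarrow> real set \<Rightarrow> real" where
  "flag F I = (if F \<inter> I \<noteq> {} then 1 else 0)"

definition sigma_sum :: "real \<Rightarrow> real set \<Rightarrow> nat \<Rightarrow> (nat \<Rightarrow> real) \<Rightarrow> real" where
  "sigma_sum \<alpha> F n x =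
     (\<Sum>i<n. (x (Suc i) - x i) powr \<alpha> / Gamma (\<alpha> + 1) * flag F {x i..x (Suc i)})"

definition coarse_mass :: "real \<Rightarrow> real set \<Rightarrow> real \<Rightarrow> real \<Rightarrow> real \<Rightarrow> ereal" where
  "coarse_mass \<alpha> F \<delta> a b =
     Inf {ereal (sigma_sum \<alpha> F n x) | n x. subdivision a b n x \<and> (\<forall>i<n. x (Suc i) - x i \<le> \<delta>)}"

text \<open>The mass function \<open>\<gamma>\<^sup>\<alpha>(F,a,b)\<close>. The coarse mass increases as \<open>\<delta>\<close> decreases to 0,
  so the limit always exists in the extended reals, but it may be \<open>\<infinity>\<close>.\<close>

definition mass :: "real \<Rightarrow> real set \<Rightarrow> real \<Rightarrow> real \<Rightarrow> ereal" where
  "mass \<alpha> F a b = Lim (at_right 0) (\<lambda>\<delta>. coarse_mass \<alpha> F \<delta> a b)"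

text \<open>This is meaningful only where the mass is finite.\<close>

definition staircase :: "real \<Rightarrow> real set \<Rightarrow> real \<Rightarrow> real \<Rightarrow> real" where
  "staircase \<alpha> F l x =
     (if x \<ge> l then real_of_ereal (mass \<alpha> F l x) else - real_of_ereal (mass \<alpha> F x l))"

text \<open>The notions of \<open>F\<^sup>\<alpha>\<close>-calculus depend on \<open>\<alpha>\<close> (and on the base point of the staircase)
  only through the staircase function, which is passed below as the parameter \<open>S\<close>.

  In the derivative, \<open>A\<close> is the domain of \<open>h\<close>, so that the limit runs over the points
  of \<open>F\<close> at which \<open>h\<close> is defined; at an endpoint of \<open>A\<close> it is one-sided.\<close>

definition frac_deriv ::
  "real set \<Rightarrow> (real \<Rightarrow> real) \<Rightarrow> real set \<Rightarrow> (real \<Rightarrow> real) \<Rightarrow> real \<Rightarrow> real" where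
  "frac_deriv F S A h x =
     (if x \<in> F then Lim (at x within F \<inter> A) (\<lambda>y. (h y - h x) / (S y - S x)) else 0)"

text \<open>The family \<open>C\<^sub>F\<^sup>\<alpha>[a,b]\<close>.\<close>

definition frac_C :: "real set \<Rightarrow> (real \<Rightarrow> real) \<Rightarrow> real \<Rightarrow> real \<Rightarrow> (real \<Rightarrow> real) set" where
  "frac_C F S a b =
     {h. \<forall>x \<in> F \<inter> {a..b}. \<exists>L.
        ((\<lambda>y. (h y - h x) / (S y - S x)) \<longlongrightarrow> L) (at x within F \<inter> {a..b})}"

definition upper_sum ::
  "real set \<Rightarrow> (real \<Rightarrow> real) \<Rightarrow> (real \<Rightarrow> real) \<Rightarrow> nat \<Rightarrow> (nat \<Rightarrow> real) \<Rightarrow> real" where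
  "upper_sum F S h n x =
     (\<Sum>i<n. (if F \<inter> {x i..x (Suc i)} = {} then 0 else (SUP y \<in> F \<inter> {x i..x (Suc i)}. h y))
              * (S (x (Suc i)) - S (x i)))"

definition lower_sum ::
  "real set \<Rightarrow> (real \<Rightarrow> real) \<Rightarrow> (real \<Rightarrow> real) \<Rightarrow> nat \<Rightarrow> (nat \<Rightarrow> real) \<Rightarrow> real" where
  "lower_sum F S h n x =
     (\<Sum>i<n. (if F \<inter> {x i..x (Suc i)} = {} then 0 else (INF y \<in> F \<inter> {x i..x (Suc i)}. h y))
              * (S (x (Suc i)) - S (x i)))"

definition upper_integral ::
  "real set \<Rightarrow> (real \<Rightarrow> real) \<Rightarrow> (real \<Rightarrow> real) \<Rightarrow> real \<Rightarrow> real \<Rightarrow> real" where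
  "upper_integral F S h a b = Inf {upper_sum F S h n x | n x. subdivision a b n x}"

definition lower_integral ::
  "real set \<Rightarrow> (real \<Rightarrow> real) \<Rightarrow> (real \<Rightarrow> real) \<Rightarrow> real \<Rightarrow> real \<Rightarrow> real" where
  "lower_integral F S h a b = Sup {lower_sum F S h n x | n x. subdivision a b n x}"

text \<open>Boundedness makes the suprema and infima in the sums genuine real numbers. Used for
  \<open>a \<le> b\<close> only.\<close>

definition frac_integrable ::
  "real set \<Rightarrow> (real \<Rightarrow> real) \<Rightarrow> (real \<Rightarrow> real) \<Rightarrow> real \<Rightarrow> real \<Rightarrow> bool" where
  "frac_integrable F S h a b \<longleftrightarrow>
     bounded (h ` (F \<inter> {a..b})) \<and> upper_integral F S h a b = lower_integral F S h a b"

definition frac_integral ::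
  "real set \<Rightarrow> (real \<Rightarrow> real) \<Rightarrow> (real \<Rightarrow> real) \<Rightarrow> real \<Rightarrow> real \<Rightarrow> real" where
  "frac_integral F S h a b = upper_integral F S h a b"

text \<open>The improper integral over \<open>[a,\<infinity>)\<close>.\<close>

definition frac_integrable_inf ::
  "real set \<Rightarrow> (real \<Rightarrow> real) \<Rightarrow> (real \<Rightarrow> real) \<Rightarrow> real \<Rightarrow> bool" where
  "frac_integrable_inf F S h a \<longleftrightarrow>
     (\<forall>b\<ge>a. frac_integrable F S h a b) \<and> (\<exists>I. ((\<lambda>b. frac_integral F S h a b) \<longlongrightarrow> I) at_top)"

definition frac_integral_inf ::
  "real set \<Rightarrow> (real \<Rightarrow> real) \<Rightarrow> (real \<Rightarrow> real) \<Rightarrow> real \<Rightarrow> real" where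
  "frac_integral_inf F S h a = Lim at_top (\<lambda>b. frac_integral F S h a b)"

text \<open>The transforms take the transformed object as a function \<open>G\<close> of \<open>t\<close>; the transform of
  \<open>g\<close> is obtained for \<open>G t = g (S t)\<close>.\<close>

definition laplace_exists ::
  "real set \<Rightarrow> (real \<Rightarrow> real) \<Rightarrow> (real \<Rightarrow> real) \<Rightarrow> real \<Rightarrow> bool" where
  "laplace_exists F S G v \<longleftrightarrow> frac_integrable_inf F S (\<lambda>t. exp (- (S v * S t)) * G t) 0"

definition laplace ::
  "real set \<Rightarrow> (real \<Rightarrow> real) \<Rightarrow> (real \<Rightarrow> real) \<Rightarrow> real \<Rightarrow> real" where
  "laplace F S G v = frac_integral_inf F S (\<lambda>t. exp (- (S v * S t)) * G t) 0"

definition sumudu_exists ::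
  "real set \<Rightarrow> (real \<Rightarrow> real) \<Rightarrow> (real \<Rightarrow> real) \<Rightarrow> real \<Rightarrow> bool" where
  "sumudu_exists F S G v \<longleftrightarrow>
     S v \<noteq> 0 \<and> frac_integrable_inf F S (\<lambda>t. exp (- (S t / S v)) * G t) 0"

definition sumudu ::
  "real set \<Rightarrow> (real \<Rightarrow> real) \<Rightarrow> (real \<Rightarrow> real) \<Rightarrow> real \<Rightarrow> real" where
  "sumudu F S G v = 1 / S v * frac_integral_inf F S (\<lambda>t. exp (- (S t / S v)) * G t) 0"

definition wsk_integrand ::
  "real set \<Rightarrow> (real \<Rightarrow> real) \<Rightarrow> real \<Rightarrow> real \<Rightarrow> (real \<Rightarrow> real) \<Rightarrow> real \<Rightarrow> real \<Rightarrow> real" where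
  "wsk_integrand F S \<gamma> a f t \<tau> =
     exp (- (\<gamma> * (S t - S \<tau>) / (1 - \<gamma>))) * frac_deriv F S {a..} (\<lambda>s. f (S s)) \<tau>"

definition wsk_exists ::
  "real set \<Rightarrow> (real \<Rightarrow> real) \<Rightarrow> real \<Rightarrow> real \<Rightarrow> (real \<Rightarrow> real) \<Rightarrow> real \<Rightarrow> bool" where
  "wsk_exists F S \<gamma> a f t \<longleftrightarrow> frac_integrable F S (wsk_integrand F S \<gamma> a f t) a t"

text \<open>The wsk-fractal time derivative of \<open>f(S(t))\<close>, as a function of \<open>t \<ge> a\<close>.\<close>

definition wsk_deriv ::
  "real set \<Rightarrow> (real \<Rightarrow> real) \<Rightarrow> (real \<Rightarrow> real) \<Rightarrow> real \<Rightarrow> real \<Rightarrow> (real \<Rightarrow> real) \<Rightarrow> real \<Rightarrow> real" where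
  "wsk_deriv F S N \<gamma> a f t =
     N \<gamma> / (1 - \<gamma>) * frac_integral F S (wsk_integrand F S \<gamma> a f t) a t"

end

theory Submission
  imports Defs
begin

text \<open>The staircase \<open>S\<close> is continuous, nondecreasing and constant on intervals missing \<open>F\<close>, and every
  value of \<open>S\<close> outside the countable set of plateau values is taken at a single point, which lies
  in \<open>F\<close>. The substitution \<open>u = S t\<close> therefore turns \<open>F\<^sup>\<alpha>\<close>-calculus into ordinary calculus up to
  countably many exceptional values: the hypothesis on \<open>f\<close> makes it continuous, and differentiable
  off the plateau values, while upper and lower sums bracket the increments of any continuous
  function that is a primitive off the plateau values. With \<open>c = \<gamma> / (1 - \<gamma>)\<close> the wsk-derivative
  becomes a constant multiple of \<open>f(u) - y(u)\<close> with \<open>u = S t\<close>, where \<open>y' = c (f - y)\<close> and \<open>y(0) = f(0)\<close>.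
  Taking the Laplace transform of this linear equation gives the first formula, and the second one is
  the first at the reciprocal parameter.\<close>

section \<open>The mass function and the staircase\<close>

lemma exists_subdivision:
  assumes "a \<le> b" "0 < \<delta>"
  obtains n x where "subdivision a b n x" "\<forall>i<n. x (Suc i) - x i \<le> \<delta>"
proof (cases "a = b")
  case True
  then show ?thesis
    using that[of 0 "\<lambda>_. a"] by (simp add: subdivision_def)
next
  case False
  obtain n where n: "(b - a) / \<delta> < real n"
    using reals_Archimedean2 by blast
  have "0 < (b - a) / \<delta>"
    using assms False by simp
  with n have n0: "0 < real n"
    by linarith
  have step: "(a + real (Suc i) * ((b - a) / n)) - (a + real i * ((b - a) / n)) = (b - a) / n" for i
    by (simp only: of_nat_Suc) argo
  have pos: "0 < (b - a) / n"
    using n0 assms False by simp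
  have le: "(b - a) / n \<le> \<delta>"
    using n n0 assms by (simp add: field_simps)
  show ?thesis
  proof (rule that[of n "\<lambda>i. a + real i * ((b - a) / n)"])
    show "subdivision a b n (\<lambda>i. a + real i * ((b - a) / n))"
      unfolding subdivision_def
    proof (intro conjI allI impI)
      show "a + real i * ((b - a) / n) < a + real (Suc i) * ((b - a) / n)" for i
        using step[of i] pos by linarith
    qed (use n0 in auto)
    show "\<forall>i<n. (a + real (Suc i) * ((b - a) / n)) - (a + real i * ((b - a) / n)) \<le> \<delta>"
      unfolding step using le by simp
  qed
qed

lemma subdivision_range:
  assumes "subdivision a b n x" "i \<le> n"
  shows "a \<le> x i" "x i \<le> b"
proof -
  have mono: "x j \<le> x k" if "j \<le> k" "k \<le> n" for j k
    using that
  proof (induction rule: dec_induct)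
    case (step m)
    then have "x m < x (Suc m)"
      using assms(1) by (simp add: subdivision_def)
    with step show ?case by simp
  qed simp
  show "a \<le> x i" "x i \<le> b"
    using mono[of 0 i] mono[of i n] assms by (auto simp: subdivision_def)
qed

section \<open>Coarse sums at a fixed mesh and their approximate additivity\<close>

lemma sigma_sum_nonneg:
  assumes "0 < \<alpha>"
  shows "0 \<le> sigma_sum \<alpha> F n x"
proof -
  have "0 < Gamma (\<alpha> + 1)"
    using assms by simp
  then show ?thesis
    unfolding sigma_sum_def flag_def by (intro sum_nonneg) simp
qed

text \<open>The sums behind \<open>coarse_mass\<close>, kept as a set of reals so that infima can be
  handled by real arithmetic before any passage to \<open>ereal\<close>.\<close>

definition coarse_sums :: "real \<Rightarrow> real set \<Rightarrow> real \<Rightarrow> real \<Rightarrow> real \<Rightarrow> real set" where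
  "coarse_sums \<alpha> F \<delta> a b =
     {sigma_sum \<alpha> F n x | n x. subdivision a b n x \<and> (\<forall>i<n. x (Suc i) - x i \<le> \<delta>)}"

lemma coarse_sumsI:
  "subdivision a b n x \<Longrightarrow> \<forall>i<n. x (Suc i) - x i \<le> \<delta> \<Longrightarrow> sigma_sum \<alpha> F n x \<in> coarse_sums \<alpha> F \<delta> a b"
  unfolding coarse_sums_def by blast

lemma coarse_sums_nonempty:
  assumes "a \<le> b" "0 < \<delta>"
  shows "coarse_sums \<alpha> F \<delta> a b \<noteq> {}"
proof -
  obtain n x where "subdivision a b n x" "\<forall>i<n. x (Suc i) - x i \<le> \<delta>"
    using exists_subdivision[OF assms] .
  from coarse_sumsI[OF this] show ?thesis
    by (rule ex_in_conv[THEN iffD1, OF exI])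
qed

lemma coarse_sums_nonneg: "0 < \<alpha> \<Longrightarrow> s \<in> coarse_sums \<alpha> F \<delta> a b \<Longrightarrow> 0 \<le> s"
  unfolding coarse_sums_def by (auto simp: sigma_sum_nonneg)

lemma bdd_below_coarse_sums: "0 < \<alpha> \<Longrightarrow> bdd_below (coarse_sums \<alpha> F \<delta> a b)"
  by (rule bdd_belowI[of _ 0]) (rule coarse_sums_nonneg)

text \<open>The sums form a nonempty set of nonnegative reals, so at a fixed mesh the infimum is
  finite. An infinite value can arise only in the limit of vanishing mesh.\<close>

lemma coarse_mass_eq_ereal:
  assumes "0 < \<alpha>" "a \<le> b" "0 < \<delta>"
  shows "coarse_mass \<alpha> F \<delta> a b = ereal (Inf (coarse_sums \<alpha> F \<delta> a b))"
proof -
  have "coarse_mass \<alpha> F \<delta> a b = Inf (ereal ` coarse_sums \<alpha> F \<delta> a b)"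
    unfolding coarse_mass_def coarse_sums_def
    by (rule arg_cong[where f = Inf]) blast
  moreover have "0 \<le> Inf (ereal ` coarse_sums \<alpha> F \<delta> a b)"
    using coarse_sums_nonneg[OF assms(1)] by (auto intro!: INF_greatest)
  moreover obtain s where "s \<in> coarse_sums \<alpha> F \<delta> a b"
    using coarse_sums_nonempty[OF assms(2,3)] by blast
  then have "Inf (ereal ` coarse_sums \<alpha> F \<delta> a b) \<le> ereal s"
    by (rule INF_lower)
  ultimately show ?thesis
    by (subst ereal_Inf) auto
qed

lemma coarse_inf_le:
  assumes "0 < \<alpha>" "subdivision a b n x" "\<forall>i<n. x (Suc i) - x i \<le> \<delta>"
  shows "Inf (coarse_sums \<alpha> F \<delta> a b) \<le> sigma_sum \<alpha> F n x"
  using cInf_lower[OF coarse_sumsI[OF assms(2,3)] bdd_below_coarse_sums[OF assms(1)]] .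

lemma coarse_inf_nonneg:
  assumes "0 < \<alpha>" "a \<le> b" "0 < \<delta>"
  shows "0 \<le> Inf (coarse_sums \<alpha> F \<delta> a b)"
  using cInf_greatest[OF coarse_sums_nonempty[OF assms(2,3)]] coarse_sums_nonneg[OF assms(1)] by blast

lemma coarse_inf_antimono:
  assumes "0 < \<alpha>" "a \<le> b" "0 < \<delta>" "\<delta> \<le> \<delta>'"
  shows "Inf (coarse_sums \<alpha> F \<delta>' a b) \<le> Inf (coarse_sums \<alpha> F \<delta> a b)"
proof (rule cInf_superset_mono[OF coarse_sums_nonempty[OF assms(2,3)] bdd_below_coarse_sums[OF assms(1)]])
  show "coarse_sums \<alpha> F \<delta> a b \<subseteq> coarse_sums \<alpha> F \<delta>' a b"
    unfolding coarse_sums_def using assms(4) by (blast intro: order_trans)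
qed

lemma coarse_inf_single:
  assumes "0 < \<alpha>" "a \<le> b" "b - a \<le> \<delta>"
  shows "Inf (coarse_sums \<alpha> F \<delta> a b) \<le> (b - a) powr \<alpha> / Gamma (\<alpha> + 1) * flag F {a..b}"
proof (cases "a = b")
  case True
  then show ?thesis
    using coarse_inf_le[OF assms(1), of a b 0 "\<lambda>_. a" \<delta> F]
    by (simp add: subdivision_def sigma_sum_def)
next
  case False
  then show ?thesis
    using coarse_inf_le[OF assms(1), of a b 1 "\<lambda>i. if i = 0 then a else b" \<delta> F] assms
    by (simp add: subdivision_def sigma_sum_def)
qed

lemma coarse_inf_single':
  assumes "0 < \<alpha>" "a \<le> b" "b - a \<le> \<delta>"
  shows "Inf (coarse_sums \<alpha> F \<delta> a b) \<le> (b - a) powr \<alpha> / Gamma (\<alpha> + 1)"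
proof -
  have "(b - a) powr \<alpha> / Gamma (\<alpha> + 1) * flag F {a..b} \<le> (b - a) powr \<alpha> / Gamma (\<alpha> + 1)"
    using Gamma_real_pos[of "\<alpha> + 1"] assms(1) by (simp add: flag_def)
  then show ?thesis
    using coarse_inf_single[OF assms, of F] by linarith
qed

lemma coarse_sums_concat:
  assumes s: "s \<in> coarse_sums \<alpha> F \<delta> a b" and t: "t \<in> coarse_sums \<alpha> F \<delta> b c"
  shows "s + t \<in> coarse_sums \<alpha> F \<delta> a c"
proof -
  obtain n x where x: "subdivision a b n x" "\<forall>i<n. x (Suc i) - x i \<le> \<delta>" "s = sigma_sum \<alpha> F n x"
    using s unfolding coarse_sums_def by blast
  obtain m y where y: "subdivision b c m y" "\<forall>i<m. y (Suc i) - y i \<le> \<delta>" "t = sigma_sum \<alpha> F m y"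
    using t unfolding coarse_sums_def by blast
  \<comment> \<open>At the seam both descriptions agree, since \<open>x n = b = y 0\<close>; this is
    why \<open>z2\<close> also holds for \<open>i = 0\<close>.\<close>
  define z where "z = (\<lambda>i. if i \<le> n then x i else y (i - n))"
  have z1: "z i = x i" if "i \<le> n" for i
    using that by (simp add: z_def)
  have z2: "z (n + i) = y i" for i
    using x(1) y(1) by (cases i) (auto simp: z_def subdivision_def)
  have split: "P i" if "i < n + m" "\<And>i. i < n \<Longrightarrow> P i" "\<And>j. j < m \<Longrightarrow> P (n + j)" for P i
    using that by (metis less_add_eq_less le_add_diff_inverse not_le_imp_less nat_add_left_cancel_less)
  have z2': "z (Suc (n + i)) = y (Suc i)" for i
    using z2[of "Suc i"] by simp
  have "subdivision a c (n + m) z"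
    unfolding subdivision_def
  proof (intro conjI allI impI)
    show "z 0 = a"
      using x(1) by (simp add: z1 subdivision_def)
    show "z (n + m) = c"
      using y(1) by (simp add: z2 subdivision_def)
    show "z i < z (Suc i)" if "i < n + m" for i
      using that by (rule split) (use x(1) y(1) in \<open>auto simp: z1 z2 z2' subdivision_def\<close>)
  qed
  moreover have "z (Suc i) - z i \<le> \<delta>" if "i < n + m" for i
    using that by (rule split) (use x(2) y(2) in \<open>auto simp: z1 z2 z2'\<close>)
  moreover have "sigma_sum \<alpha> F (n + m) z = s + t"
  proof -
    have "(\<Sum>i<n + m. g i) = (\<Sum>i<n. g i) + (\<Sum>i<m. g (n + i))" for g :: "nat \<Rightarrow> real"
      by (induction m) auto
    then show ?thesis
      unfolding sigma_sum_def x(3) y(3) by (simp add: z1 z2 z2')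
  qed
  ultimately show ?thesis
    using coarse_sumsI[of a c "n + m" z \<delta> \<alpha> F] by simp
qed

text \<open>Concatenating subdivisions shows that \<open>s + t\<close> is again a sum for the long
  interval; the infima over \<open>s\<close> and \<open>t\<close> are then taken one after the
  other.\<close>

lemma coarse_inf_subadditive:
  assumes "0 < \<alpha>" "0 < \<delta>" "a \<le> b" "b \<le> c"
  shows "Inf (coarse_sums \<alpha> F \<delta> a c) \<le> Inf (coarse_sums \<alpha> F \<delta> a b) + Inf (coarse_sums \<alpha> F \<delta> b c)"
    (is "?ac \<le> ?ab + ?bc")
proof -
  have le: "?ac \<le> s + t" if "s \<in> coarse_sums \<alpha> F \<delta> a b" "t \<in> coarse_sums \<alpha> F \<delta> b c" for s t
    using cInf_lower[OF coarse_sums_concat[OF that] bdd_below_coarse_sums[OF assms(1)]] .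
  have "?ac - t \<le> ?ab" if "t \<in> coarse_sums \<alpha> F \<delta> b c" for t
    using le that by (intro cInf_greatest[OF coarse_sums_nonempty[OF assms(3,2)]]) (simp add: diff_le_eq)
  then have "?ac - ?ab \<le> ?bc"
    by (intro cInf_greatest[OF coarse_sums_nonempty[OF assms(4,2)]]) (simp add: algebra_simps)
  then show ?thesis by simp
qed

text \<open>Inserting the point \<open>b\<close> into a subdivision splits at most one term into two terms, each of
  which is at most \<open>\<delta>\<^sup>\<alpha> / \<Gamma>(\<alpha> + 1)\<close>.\<close>

lemma coarse_inf_insert_point:
  assumes "0 < \<alpha>" "0 < \<delta>" "subdivision a c n x" "\<forall>i<n. x (Suc i) - x i \<le> \<delta>" "a \<le> b" "b \<le> c"
  shows "Inf (coarse_sums \<alpha> F \<delta> a b) + Inf (coarse_sums \<alpha> F \<delta> b c)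
           \<le> sigma_sum \<alpha> F n x + 2 * (\<delta> powr \<alpha> / Gamma (\<alpha> + 1))"
  using assms(3-6)
proof (induction n arbitrary: c b)
  case 0
  then have "a = b" "b = c"
    by (auto simp: subdivision_def)
  moreover have "0 \<le> \<delta> powr \<alpha> / Gamma (\<alpha> + 1)"
    using Gamma_real_pos[of "\<alpha> + 1"] assms(1) by (intro divide_nonneg_pos) auto
  moreover have "Inf (coarse_sums \<alpha> F \<delta> b b) \<le> 0"
    using coarse_inf_single'[of \<alpha> b b \<delta> F] assms(1,2) by simp
  ultimately show ?case
    by (simp add: sigma_sum_def del: times_divide_eq_right)
next
  case (Suc n)
  let ?I = "\<lambda>u v. Inf (coarse_sums \<alpha> F \<delta> u v)"
  let ?d = "\<delta> powr \<alpha> / Gamma (\<alpha> + 1)"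
  have sub: "subdivision a (x n) n x" and mesh: "\<forall>i<n. x (Suc i) - x i \<le> \<delta>"
    and c: "x (Suc n) = c" "x n < c" "c - x n \<le> \<delta>"
    using Suc.prems by (auto simp: subdivision_def)
  define T where "T = (x (Suc n) - x n) powr \<alpha> / Gamma (\<alpha> + 1) * flag F {x n..x (Suc n)}"
  have sig: "sigma_sum \<alpha> F (Suc n) x = sigma_sum \<alpha> F n x + T"
    by (simp add: sigma_sum_def T_def)
  have T0: "0 \<le> T"
    using Gamma_real_pos[of "\<alpha> + 1"] assms(1) by (simp add: T_def flag_def)
  have anx: "a \<le> x n"
    using subdivision_range(1)[OF sub, of n] by simp
  have small: "?I u v \<le> ?d" if "u \<le> v" "v - u \<le> \<delta>" for u v
  proof -
    have "(v - u) powr \<alpha> \<le> \<delta> powr \<alpha>"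
      using that assms by (intro powr_mono2) auto
    then have "(v - u) powr \<alpha> / Gamma (\<alpha> + 1) \<le> ?d"
      using Gamma_real_pos[of "\<alpha> + 1"] assms(1) by (intro divide_right_mono) auto
    with coarse_inf_single'[OF assms(1) that, of F] show ?thesis by linarith
  qed
  show ?case
  \<comment> \<open>If \<open>b\<close> lies left of the last step, that step is absorbed by the
    right-hand part and the induction hypothesis covers the rest. Otherwise \<open>b\<close> cuts
    the last step into two pieces that cost at most \<open>?d\<close> each, which is the source of
    the factor 2; here \<open>T\<close> is merely dropped as nonnegative.\<close>
  proof (cases "b \<le> x n")
    case True
    have "?I b c \<le> ?I b (x n) + ?I (x n) c"
      using coarse_inf_subadditive[OF assms(1,2) True] c by simp
    moreover have "?I (x n) c \<le> T"
      unfolding T_def using coarse_inf_single[of \<alpha> "x n" c \<delta> F] c assms(1) by simp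
    moreover have "?I a b + ?I b (x n) \<le> sigma_sum \<alpha> F n x + 2 * ?d"
      using Suc.IH[OF sub mesh Suc.prems(3) True] .
    ultimately show ?thesis
      unfolding sig by linarith
  next
    case False
    have "?I a b \<le> ?I a (x n) + ?I (x n) b"
      using coarse_inf_subadditive[OF assms(1,2) anx] False by simp
    moreover have "?I a (x n) \<le> sigma_sum \<alpha> F n x"
      using coarse_inf_le[OF assms(1) sub mesh] .
    moreover have "?I (x n) b \<le> ?d" "?I b c \<le> ?d"
      using False Suc.prems(4) c by (auto intro!: small)
    ultimately show ?thesis
      unfolding sig using T0 by linarith
  qed
qed

text \<open>The error term vanishes with the mesh, so together with subadditivity this yields exact
  additivity of the mass in the limit.\<close>

lemma coarse_inf_superadditive:
  assumes "0 < \<alpha>" "0 < \<delta>" "a \<le> b" "b \<le> c"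
  shows "Inf (coarse_sums \<alpha> F \<delta> a b) + Inf (coarse_sums \<alpha> F \<delta> b c)
           \<le> Inf (coarse_sums \<alpha> F \<delta> a c) + 2 * (\<delta> powr \<alpha> / Gamma (\<alpha> + 1))"
proof -
  have "Inf (coarse_sums \<alpha> F \<delta> a b) + Inf (coarse_sums \<alpha> F \<delta> b c) - 2 * (\<delta> powr \<alpha> / Gamma (\<alpha> + 1))
          \<le> Inf (coarse_sums \<alpha> F \<delta> a c)"
  proof (rule cInf_greatest)
    show "coarse_sums \<alpha> F \<delta> a c \<noteq> {}"
      using coarse_sums_nonempty assms by simp
    fix s assume "s \<in> coarse_sums \<alpha> F \<delta> a c"
    then obtain n x where "subdivision a c n x" "\<forall>i<n. x (Suc i) - x i \<le> \<delta>" "s = sigma_sum \<alpha> F n x"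
      unfolding coarse_sums_def by blast
    then show "Inf (coarse_sums \<alpha> F \<delta> a b) + Inf (coarse_sums \<alpha> F \<delta> b c)
        - 2 * (\<delta> powr \<alpha> / Gamma (\<alpha> + 1)) \<le> s"
      using coarse_inf_insert_point[OF assms(1,2) _ _ assms(3,4)] by (simp add: diff_le_eq)
  qed
  then show ?thesis by simp
qed

section \<open>The mass function as a limit of real infima\<close>

lemma mass_eq_SUP:
  assumes "0 < \<alpha>" "a \<le> b"
  shows "mass \<alpha> F a b = (SUP \<delta>\<in>{0<..}. ereal (Inf (coarse_sums \<alpha> F \<delta> a b)))" (is "_ = ?S")
    and "((\<lambda>\<delta>. ereal (Inf (coarse_sums \<alpha> F \<delta> a b))) \<longlongrightarrow> mass \<alpha> F a b) (at_right 0)"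
proof -
  \<comment> \<open>The infimum grows as the mesh shrinks, so its limit at 0 from the right is its
    supremum.\<close>
  have lim: "((\<lambda>\<delta>. ereal (Inf (coarse_sums \<alpha> F \<delta> a b))) \<longlongrightarrow> ?S) (at_right 0)"
  proof (rule order_tendstoI)
    fix r assume "r < ?S"
    then obtain d where d: "0 < d" "r < ereal (Inf (coarse_sums \<alpha> F d a b))"
      by (auto simp: less_SUP_iff)
    have "\<forall>\<^sub>F \<delta> in at_right 0. 0 < \<delta> \<and> \<delta> < d"
      using d(1) by (auto simp: eventually_at_right)
    then show "\<forall>\<^sub>F \<delta> in at_right 0. r < ereal (Inf (coarse_sums \<alpha> F \<delta> a b))"
    proof eventually_elim
      case (elim \<delta>)
      then have "ereal (Inf (coarse_sums \<alpha> F d a b)) \<le> ereal (Inf (coarse_sums \<alpha> F \<delta> a b))"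
        using coarse_inf_antimono[OF assms] by simp
      with d(2) show ?case by (rule less_le_trans)
    qed
  next
    fix r assume r: "?S < r"
    have "\<forall>\<^sub>F \<delta>::real in at_right 0. 0 < \<delta>"
      by (simp add: eventually_at_right_less)
    then show "\<forall>\<^sub>F \<delta> in at_right 0. ereal (Inf (coarse_sums \<alpha> F \<delta> a b)) < r"
    proof eventually_elim
      case (elim \<delta>)
      then have "ereal (Inf (coarse_sums \<alpha> F \<delta> a b)) \<le> ?S"
        by (intro SUP_upper) simp
      with r show ?case by (rule le_less_trans[rotated])
    qed
  qed
  have "\<forall>\<^sub>F \<delta>::real in at_right 0. 0 < \<delta>"
    by (simp add: eventually_at_right_less)
  then have "\<forall>\<^sub>F \<delta> in at_right 0. ereal (Inf (coarse_sums \<alpha> F \<delta> a b)) = coarse_mass \<alpha> F \<delta> a b"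
    by eventually_elim (simp add: coarse_mass_eq_ereal assms)
  with lim have "((\<lambda>\<delta>. coarse_mass \<alpha> F \<delta> a b) \<longlongrightarrow> ?S) (at_right 0)"
    by (rule Lim_transform_eventually)
  then show eq: "mass \<alpha> F a b = ?S"
    unfolding mass_def by (rule tendsto_Lim[OF trivial_limit_at_right_real])
  show "((\<lambda>\<delta>. ereal (Inf (coarse_sums \<alpha> F \<delta> a b))) \<longlongrightarrow> mass \<alpha> F a b) (at_right 0)"
    unfolding eq by (rule lim)
qed

lemma mass_eq_ereal:
  assumes "0 < \<alpha>" "a \<le> b" "mass \<alpha> F a b < \<infinity>"
  shows "mass \<alpha> F a b = ereal (real_of_ereal (mass \<alpha> F a b))"
proof -
  have "0 \<le> ereal (Inf (coarse_sums \<alpha> F 1 a b))"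
    using coarse_inf_nonneg[OF assms(1,2), of 1 F] by simp
  also have "\<dots> \<le> mass \<alpha> F a b"
    unfolding mass_eq_SUP(1)[OF assms(1,2)] by (rule SUP_upper) simp
  finally have "0 \<le> mass \<alpha> F a b" .
  with assms(3) show ?thesis
    by (cases "mass \<alpha> F a b") simp_all
qed

lemma coarse_inf_tendsto_mass:
  assumes "0 < \<alpha>" "a \<le> b" "mass \<alpha> F a b < \<infinity>"
  shows "((\<lambda>\<delta>. Inf (coarse_sums \<alpha> F \<delta> a b)) \<longlongrightarrow> real_of_ereal (mass \<alpha> F a b)) (at_right 0)"
proof -
  obtain m where "mass \<alpha> F a b = ereal m"
    using mass_eq_ereal[OF assms] by blast
  with mass_eq_SUP(2)[OF assms(1,2), of F] show ?thesis
    by simp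
qed

lemma coarse_inf_le_mass:
  assumes "0 < \<alpha>" "a \<le> b" "mass \<alpha> F a b < \<infinity>" "0 < \<delta>"
  shows "Inf (coarse_sums \<alpha> F \<delta> a b) \<le> real_of_ereal (mass \<alpha> F a b)"
proof -
  have "ereal (Inf (coarse_sums \<alpha> F \<delta> a b)) \<le> mass \<alpha> F a b"
    unfolding mass_eq_SUP(1)[OF assms(1,2)] using assms(4) by (intro SUP_upper) simp
  moreover obtain m where "mass \<alpha> F a b = ereal m"
    using mass_eq_ereal[OF assms(1-3)] by blast
  ultimately show ?thesis
    by simp
qed

section \<open>Additivity and continuity of a finite mass, and the staircase\<close>

lemma tendsto_powr_at_right_0:
  fixes \<alpha> :: real
  assumes "0 < \<alpha>"
  shows "((\<lambda>\<delta>. \<delta> powr \<alpha> / Gamma (\<alpha> + 1)) \<longlongrightarrow> 0) (at_right 0)"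
proof -
  have "((\<lambda>\<delta>. \<delta> powr \<alpha>) \<longlongrightarrow> 0 powr \<alpha>) (at_right 0)"
    using assms eventually_mono[OF eventually_at_right_less[of "0::real"] less_imp_le]
    by (intro tendsto_powr2 tendsto_ident_at tendsto_const) auto
  then have "((\<lambda>\<delta>. \<delta> powr \<alpha> / Gamma (\<alpha> + 1)) \<longlongrightarrow> 0 powr \<alpha> / Gamma (\<alpha> + 1)) (at_right 0)"
    using Gamma_real_pos[of "\<alpha> + 1"] assms
    by (intro tendsto_divide tendsto_const) (auto simp del: Gamma_real_pos)
  then show ?thesis
    using assms by simp
qed

text \<open>Finiteness on all bounded intervals makes the conversion by \<open>real_of_ereal\<close>
  in the definition of the staircase faithful.\<close>

locale finite_mass =
  fixes \<alpha> :: real and F :: "real set"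
  assumes \<alpha>_pos: "0 < \<alpha>"
    and finite_mass: "\<And>x y. x \<le> y \<Longrightarrow> mass \<alpha> F x y < \<infinity>"
begin

definition rmass :: "real \<Rightarrow> real \<Rightarrow> real" where
  "rmass x y = real_of_ereal (mass \<alpha> F x y)"

lemma coarse_tendsto_rmass:
  "a \<le> b \<Longrightarrow> ((\<lambda>\<delta>. Inf (coarse_sums \<alpha> F \<delta> a b)) \<longlongrightarrow> rmass a b) (at_right 0)"
  unfolding rmass_def by (rule coarse_inf_tendsto_mass[OF \<alpha>_pos _ finite_mass])

lemma rmass_add:
  assumes "a \<le> b" "b \<le> c"
  shows "rmass a b + rmass b c = rmass a c"
proof (rule antisym)
  have pos: "\<forall>\<^sub>F \<delta>::real in at_right 0. 0 < \<delta>"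
    by (simp add: eventually_at_right_less)
  have ac: "a \<le> c"
    using assms by simp
  note lims = coarse_tendsto_rmass[OF assms(1)] coarse_tendsto_rmass[OF assms(2)]
    coarse_tendsto_rmass[OF ac]
  show "rmass a c \<le> rmass a b + rmass b c"
    by (rule tendsto_le[OF _ tendsto_add[OF lims(1,2)] lims(3)])
      (use pos in \<open>auto elim!: eventually_mono intro!: coarse_inf_subadditive \<alpha>_pos assms\<close>)
  have "((\<lambda>\<delta>. Inf (coarse_sums \<alpha> F \<delta> a c) + 2 * (\<delta> powr \<alpha> / Gamma (\<alpha> + 1)))
      \<longlongrightarrow> rmass a c + 2 * 0) (at_right 0)"
    by (intro tendsto_intros lims tendsto_powr_at_right_0 \<alpha>_pos)
  then show "rmass a b + rmass b c \<le> rmass a c"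
    using pos
    by (intro tendsto_le[OF trivial_limit_at_right_real _ tendsto_add[OF lims(1,2)]])
      (auto elim!: eventually_mono intro!: coarse_inf_superadditive \<alpha>_pos assms simp del: times_divide_eq_right)
qed

lemma rmass_nonneg:
  assumes "a \<le> b"
  shows "0 \<le> rmass a b"
  using coarse_inf_nonneg[OF \<alpha>_pos assms, of 1 F]
    coarse_inf_le_mass[OF \<alpha>_pos assms finite_mass[OF assms], of 1]
  by (simp add: rmass_def)

lemma rmass_eq_0:
  assumes "a \<le> b" "F \<inter> {a..b} = {}"
  shows "rmass a b = 0"
proof -
  have "Inf (coarse_sums \<alpha> F \<delta> a b) \<le> 0" if \<delta>: "0 < \<delta>" for \<delta>
  proof -
    obtain n x where x: "subdivision a b n x" "\<forall>i<n. x (Suc i) - x i \<le> \<delta>"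
      using exists_subdivision[OF assms(1) \<delta>] .
    have "flag F {x i..x (Suc i)} = 0" if "i < n" for i
      using subdivision_range(1)[OF x(1), of i] subdivision_range(2)[OF x(1), of "Suc i"] that assms(2)
      unfolding flag_def by fastforce
    then have "sigma_sum \<alpha> F n x = 0"
      unfolding sigma_sum_def by (intro sum.neutral) auto
    then show ?thesis
      using coarse_inf_le[OF \<alpha>_pos x, of F] by simp
  qed
  then have "\<forall>\<^sub>F \<delta> in at_right 0. Inf (coarse_sums \<alpha> F \<delta> a b) \<le> 0"
    by (intro eventually_mono[OF eventually_at_right_less[of 0]]) simp
  then have "rmass a b \<le> 0"
    using coarse_tendsto_rmass[OF assms(1)] by (intro tendsto_upperbound) auto
  with rmass_nonneg[OF assms(1)] show ?thesis by simp
qed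

text \<open>Choose a mesh at which the coarse infimum on the whole interval is within half of the
  tolerance of the mass. A short subinterval adds less than the other half to that infimum, and the
  two outer parts add at most their masses. By additivity the mass of the subinterval itself is then
  below the tolerance.\<close>

lemma rmass_small:
  assumes "a \<le> b" "0 < \<epsilon>"
  obtains \<delta> where "0 < \<delta>"
    "\<And>x y. a \<le> x \<Longrightarrow> x \<le> y \<Longrightarrow> y \<le> b \<Longrightarrow> y - x \<le> \<delta> \<Longrightarrow> rmass x y < \<epsilon>"
proof -
  have "\<forall>\<^sub>F \<delta> in at_right 0. rmass a b - \<epsilon> / 2 < Inf (coarse_sums \<alpha> F \<delta> a b)"
    using order_tendstoD(1)[OF coarse_tendsto_rmass[OF assms(1)]] assms(2) by simp
  moreover have "\<forall>\<^sub>F \<delta> in at_right 0. \<delta> powr \<alpha> / Gamma (\<alpha> + 1) < \<epsilon> / 2"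
    using order_tendstoD(2)[OF tendsto_powr_at_right_0[OF \<alpha>_pos], of "\<epsilon> / 2"] assms(2)
    by simp
  ultimately have "\<forall>\<^sub>F \<delta> in at_right 0. 0 < \<delta> \<and> rmass a b - \<epsilon> / 2 < Inf (coarse_sums \<alpha> F \<delta> a b)
      \<and> \<delta> powr \<alpha> / Gamma (\<alpha> + 1) < \<epsilon> / 2"
    using eventually_at_right_less[of 0] by eventually_elim simp
  then obtain \<delta> where \<delta>: "0 < \<delta>" "rmass a b - \<epsilon> / 2 < Inf (coarse_sums \<alpha> F \<delta> a b)"
      "\<delta> powr \<alpha> / Gamma (\<alpha> + 1) < \<epsilon> / 2"
    using eventually_happens'[of "at_right (0::real)"] by force
  show ?thesis
  proof (rule that[OF \<delta>(1)])
    fix x y assume xy: "a \<le> x" "x \<le> y" "y \<le> b" "y - x \<le> \<delta>"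
    let ?I = "\<lambda>u v. Inf (coarse_sums \<alpha> F \<delta> u v)"
    have "?I a b \<le> ?I a x + (?I x y + ?I y b)"
      using coarse_inf_subadditive[OF \<alpha>_pos \<delta>(1), of a x b F]
        coarse_inf_subadditive[OF \<alpha>_pos \<delta>(1), of x y b F] xy by simp
    moreover have "?I a x \<le> rmass a x" "?I y b \<le> rmass y b"
      unfolding rmass_def using xy \<delta>(1) by (auto intro!: coarse_inf_le_mass \<alpha>_pos finite_mass simp del: less_ereal.simps)
    moreover have "?I x y \<le> (y - x) powr \<alpha> / Gamma (\<alpha> + 1)"
      using coarse_inf_single'[OF \<alpha>_pos xy(2,4)] .
    moreover have "(y - x) powr \<alpha> / Gamma (\<alpha> + 1) \<le> \<delta> powr \<alpha> / Gamma (\<alpha> + 1)"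
      using xy \<alpha>_pos Gamma_real_pos[of "\<alpha> + 1"] by (intro divide_right_mono powr_mono2) auto
    moreover have "rmass a b = rmass a x + (rmass x y + rmass y b)"
      using rmass_add[of a x b] rmass_add[of x y b] xy by simp
    ultimately show "rmass x y < \<epsilon>"
      using \<delta>(2,3) by linarith
  qed
qed

text \<open>The base point cancels by additivity of the mass; the three instances treat
  \<open>l\<close> to the left of, between and to the right of \<open>x\<close> and
  \<open>y\<close>.\<close>

lemma staircase_diff:
  assumes "x \<le> y"
  shows "staircase \<alpha> F l y - staircase \<alpha> F l x = rmass x y"
  using rmass_add[of l x y] rmass_add[of x l y] rmass_add[of x y l] assms
  unfolding staircase_def rmass_def by auto

lemma staircase_mono: "mono (staircase \<alpha> F l)"
  by (rule monoI) (use staircase_diff[of _ _ l] rmass_nonneg in \<open>smt (verit)\<close>)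

lemma continuous_staircase: "continuous_on UNIV (staircase \<alpha> F l)"
  unfolding continuous_on_iff
proof (intro ballI allI impI)
  fix x \<epsilon> :: real assume "0 < \<epsilon>"
  then obtain \<delta> where \<delta>: "0 < \<delta>" and
    small: "\<And>u v. x - 1 \<le> u \<Longrightarrow> u \<le> v \<Longrightarrow> v \<le> x + 1 \<Longrightarrow> v - u \<le> \<delta> \<Longrightarrow> rmass u v < \<epsilon>"
    using rmass_small[of "x - 1" "x + 1" \<epsilon>] by auto
  have "dist (staircase \<alpha> F l y) (staircase \<alpha> F l x) < \<epsilon>" if "dist y x < min \<delta> 1" for y
  proof (cases "x \<le> y")
    case True
    then have "rmass x y < \<epsilon>"
      using that by (intro small) (auto simp: dist_real_def)
    then show ?thesis
      using staircase_diff[OF True, of l] rmass_nonneg[OF True] by (simp add: dist_real_def)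
  next
    case False
    then have "rmass y x < \<epsilon>"
      using that by (intro small) (auto simp: dist_real_def)
    then show ?thesis
      using staircase_diff[of y x l] rmass_nonneg[of y x] False by (simp add: dist_real_def)
  qed
  then show "\<exists>d>0. \<forall>y\<in>UNIV. dist y x < d \<longrightarrow> dist (staircase \<alpha> F l y) (staircase \<alpha> F l x) < \<epsilon>"
    using \<delta> by (intro exI[of _ "min \<delta> 1"]) simp
qed

end

section \<open>Real analysis with countable exceptional sets\<close>

text \<open>A value \<open>w\<close> between \<open>H a\<close> and \<open>H b\<close> that is not attained on \<open>C\<close> is crossed upwards at
  its last preimage, where the derivative of \<open>H\<close> would be negative.\<close>

lemma increment_le_countable:
  fixes G :: "real \<Rightarrow> real"
  assumes "a \<le> b" "continuous_on {a..b} G" "countable C"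
    and deriv: "\<And>u. a < u \<Longrightarrow> u < b \<Longrightarrow> u \<notin> C \<Longrightarrow> \<exists>D\<le>M. (G has_real_derivative D) (at u)"
  shows "G b - G a \<le> M * (b - a)"
proof (rule ccontr)
  assume "\<not> ?thesis"
  then have less: "M * (b - a) < G b - G a" by simp
  then have ab: "a < b"
    using assms(1) by (cases "a = b") auto
  have "M < (G b - G a) / (b - a)"
    using less ab by (simp add: pos_less_divide_eq)
  \<comment> \<open>Tilting \<open>G\<close> by a slope strictly between \<open>M\<close> and the
    mean slope makes \<open>H\<close> rise from \<open>a\<close> to \<open>b\<close>, although its
    derivative is negative at every interior point off \<open>C\<close>.\<close>
  then obtain M' where M': "M < M'" "M' < (G b - G a) / (b - a)"
    using dense by blast
  define H where "H t = G t - M' * t" for t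
  have "M' * (b - a) < G b - G a"
    using M'(2) ab by (simp add: pos_less_divide_eq)
  then have Hab: "H a < H b"
    by (simp add: H_def algebra_simps)
  have contH: "continuous_on {a..b} H"
    unfolding H_def by (intro continuous_intros assms(2))
  \<comment> \<open>The image of the exceptional set is countable, while an open interval of values
    is not.\<close>
  have "\<not> {H a<..<H b} \<subseteq> H ` C"
    using uncountable_open_interval[of "H a" "H b"] Hab countable_image[OF assms(3), of H]
      countable_subset by blast
  then obtain w where "w \<in> {H a<..<H b}" and w: "w \<notin> H ` C"
    by blast
  then have w: "H a < w" "w < H b" "w \<notin> H ` C"
    by auto
  have "closed ({a..b} \<inter> H -` {..w})"
    by (rule continuous_closed_preimage[OF contH]) auto
  then have "compact ({a..b} \<inter> H -` {..w})"
    by (metis compact_Icc compact_Int_closed inf.left_idem)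
  moreover have "a \<in> {a..b} \<inter> H -` {..w}"
    using w ab by auto
  ultimately obtain s where s: "s \<in> {a..b} \<inter> H -` {..w}"
    and max: "\<And>t. t \<in> {a..b} \<inter> H -` {..w} \<Longrightarrow> t \<le> s"
    using compact_attains_sup by (metis empty_iff)
  have "s < b"
    using s w by (cases "s = b") auto
  have Hs: "H s = w"
  proof (rule ccontr)
    assume "H s \<noteq> w"
    then have "H s \<le> w" "w \<le> H b"
      using s w by auto
    moreover have "continuous_on {s..b} H"
      using contH by (rule continuous_on_subset) (use s in auto)
    ultimately obtain t where t: "s \<le> t" "t \<le> b" "H t = w"
      using IVT'[of H s w b] \<open>s < b\<close> by auto
    then have "t \<le> s"
      using s by (intro max) auto
    with t \<open>H s \<noteq> w\<close> show False by simp
  qed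
  have "a < s" "s \<notin> C"
    using s w Hs by (auto simp: less_eq_real_def)
  then obtain D where D: "D \<le> M" "(G has_real_derivative D) (at s)"
    using deriv \<open>s < b\<close> by blast
  have "(H has_real_derivative D - M') (at s)"
    unfolding H_def by (auto intro!: derivative_eq_intros D(2))
  then obtain d where d: "d > 0" "\<And>h. 0 < h \<Longrightarrow> h < d \<Longrightarrow> H (s + h) < H s"
    using DERIV_neg_dec_right[of H "D - M'" s] D(1) M'(1) by auto
  define h where "h = min (d / 2) (b - s)"
  have h: "0 < h" "h < d" "s + h \<le> b"
    using d(1) \<open>s < b\<close> by (auto simp: h_def)
  then have "s + h \<le> s"
    using d(2)[of h] Hs \<open>a < s\<close> by (intro max) auto
  with h(1) show False by simp
qed

lemma increment_ge_countable:
  fixes G :: "real \<Rightarrow> real"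
  assumes "a \<le> b" "continuous_on {a..b} G" "countable C"
    and deriv: "\<And>u. a < u \<Longrightarrow> u < b \<Longrightarrow> u \<notin> C \<Longrightarrow> \<exists>D\<ge>M. (G has_real_derivative D) (at u)"
  shows "M * (b - a) \<le> G b - G a"
proof -
  have "(- G b) - (- G a) \<le> (- M) * (b - a)"
  proof (rule increment_le_countable[OF assms(1) _ assms(3)])
    fix u assume "a < u" "u < b" "u \<notin> C"
    then obtain D where "M \<le> D" "(G has_real_derivative D) (at u)"
      using deriv by blast
    then show "\<exists>D'\<le>- M. ((\<lambda>u. - G u) has_real_derivative D') (at u)"
      by (intro exI[of _ "- D"] conjI DERIV_minus) auto
  qed (intro continuous_intros assms(2))
  then show ?thesis by simp
qed

text \<open>A continuous map from a compact space to a Hausdorff space is closed, hence a quotient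
  map onto its image. This removes \<open>S\<close> from the continuity of \<open>f\<close> composed
  with \<open>S\<close>.\<close>

lemma continuous_on_compact_quotient:
  fixes S :: "'a::topological_space \<Rightarrow> 'b::t2_space" and f :: "'b \<Rightarrow> 'c::topological_space"
  assumes "compact K" "continuous_on K S" "continuous_on K (\<lambda>x. f (S x))"
  shows "continuous_on (S ` K) f"
  unfolding continuous_closedin_preimage_eq
proof (intro allI impI)
  fix T :: "'c set" assume "closed T"
  then have "closedin (top_of_set K) (K \<inter> (\<lambda>x. f (S x)) -` T)"
    using assms(3) continuous_closedin_preimage by blast
  then have "compact (K \<inter> (\<lambda>x. f (S x)) -` T)"
    using assms(1) closedin_compact by blast
  then have "compact (S ` (K \<inter> (\<lambda>x. f (S x)) -` T))"
    by (rule compact_continuous_image[rotated]) (use assms(2) continuous_on_subset in blast)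
  moreover have "S ` K \<inter> f -` T = S ` (K \<inter> (\<lambda>x. f (S x)) -` T)"
    by auto
  ultimately show "closedin (top_of_set (S ` K)) (S ` K \<inter> f -` T)"
    by (intro closed_subset) (auto dest: compact_imp_closed)
qed

lemma DERIV_integral_at:
  fixes f :: "real \<Rightarrow> real"
  assumes "continuous_on {a..b} f" "a < u" "u < b"
  shows "((\<lambda>u. integral {a..u} f) has_real_derivative f u) (at u)"
proof -
  have "((\<lambda>u. integral {a..u} f) has_real_derivative f u) (at u within {a..b})"
    using assms by (intro integral_has_real_derivative) auto
  then show ?thesis
    using assms at_within_interior[of u "{a..b}"] by simp
qed

section \<open>Integration against a continuous increasing function supported on a closed set\<close>

text \<open>These are the properties of the staircase on which the calculus below rests. By the last
  two, the half-line of times \<open>t\<close> from 0 on is mapped onto the half-line of values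
  \<open>u = S t\<close> from 0 on.\<close>

locale closed_integrator =
  fixes F :: "real set" and S :: "real \<Rightarrow> real"
  assumes closed_F: "closed F"
    and mono_S: "mono S"
    and cont_S: "continuous_on UNIV S"
    and flat_S: "\<And>x y. x \<le> y \<Longrightarrow> F \<inter> {x..y} = {} \<Longrightarrow> S x = S y"
    and S_0: "S 0 = 0"
    and S_at_top: "filterlim S at_top at_top"
begin

lemma S_le: "x \<le> y \<Longrightarrow> S x \<le> S y"
  using mono_S by (rule monoD)

lemma S_nonneg: "0 \<le> x \<Longrightarrow> 0 \<le> S x"
  using S_le[of 0 x] S_0 by simp

lemma S_lessD: "S x < S y \<Longrightarrow> x < y"
  using S_le[of y x] by (cases "x < y") auto

text \<open>The last preimage of \<open>z\<close> in \<open>[x,y]\<close> is a point of increase and therefore lies in \<open>F\<close>.\<close>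

lemma value_attained_in_F:
  assumes "S x \<le> z" "z < S y"
  obtains t where "t \<in> F" "x \<le> t" "t < y" "S t = z"
proof -
  have xy: "x < y"
    using S_lessD assms by simp
  have cont: "continuous_on A S" for A
    using cont_S continuous_on_subset by blast
  have "closed ({x..y} \<inter> S -` {..z})"
    by (rule continuous_closed_preimage[OF cont]) auto
  then have "compact ({x..y} \<inter> S -` {..z})"
    by (metis compact_Icc compact_Int_closed inf.left_idem)
  moreover have "x \<in> {x..y} \<inter> S -` {..z}"
    using assms xy by auto
  ultimately obtain p where p: "p \<in> {x..y} \<inter> S -` {..z}"
    and max: "\<And>t. t \<in> {x..y} \<inter> S -` {..z} \<Longrightarrow> t \<le> p"
    using compact_attains_sup by (metis empty_iff)
  have "p < y"
    using p assms by (cases "p = y") auto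
  have Sp: "S p = z"
  proof (rule ccontr)
    assume "S p \<noteq> z"
    then obtain t where t: "p \<le> t" "t \<le> y" "S t = z"
      using IVT'[of S p z y] \<open>p < y\<close> p assms cont by auto
    then have "t \<le> p"
      using p by (intro max) auto
    with t \<open>S p \<noteq> z\<close> show False by simp
  qed
  have "p \<in> F"
  proof (rule ccontr)
    assume "p \<notin> F"
    then obtain e where e: "0 < e" "ball p e \<inter> F = {}"
      using closed_F by (metis ComplI disjoint_eq_subset_Compl open_Compl open_contains_ball)
    \<comment> \<open>Cutting off at \<open>y\<close> keeps \<open>q\<close> among the competitors
      for the last preimage, and the half radius keeps it inside the ball free of
      \<open>F\<close>.\<close>
    define q where "q = min (p + e / 2) y"
    have q: "p < q" "q \<le> y" "{p..q} \<subseteq> ball p e"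
      using e \<open>p < y\<close> by (auto simp: q_def dist_real_def)
    then have "S p = S q"
      using e by (intro flat_S) auto
    then have "q \<le> p"
      using p q by (intro max) auto
    with q show False by simp
  qed
  then show ?thesis
    using that p Sp \<open>p < y\<close> by auto
qed

section \<open>Plateaus of the integrator\<close>

definition plateau_values :: "real set" where
  "plateau_values = {u. \<exists>p q. p < q \<and> S p = u \<and> S q = u}"

text \<open>Between two points with a common value there is a rational, and by monotonicity it has
  the same value.\<close>

lemma countable_plateau_values: "countable plateau_values"
proof (rule countable_subset)
  show "plateau_values \<subseteq> S ` \<rat>"
  proof
    fix u assume "u \<in> plateau_values"
    then obtain p q where pq: "p < q" "S p = u" "S q = u"
      by (auto simp: plateau_values_def)
    then obtain r where "r \<in> \<rat>" "p < r" "r < q"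
      using Rats_dense_in_real by blast
    moreover from this have "S r = u"
      using S_le[of p r] S_le[of r q] pq by simp
    ultimately show "u \<in> S ` \<rat>" by blast
  qed
qed (simp add: countable_rat)

lemma S_less: "S x \<notin> plateau_values \<or> S y \<notin> plateau_values \<Longrightarrow> x < y \<Longrightarrow> S x < S y"
  using S_le[of x y] unfolding plateau_values_def by (metis (mono_tags, lifting) less_eq_real_def mem_Collect_eq)

section \<open>Darboux sums and primitives in the variable \<open>u = S t\<close>\<close>

lemma piece_bounds:
  assumes "0 \<le> x" "x \<le> y" "continuous_on {S x..S y} G"
    and bdd: "bounded (k ` (F \<inter> {x..y}))"
    and deriv: "\<And>t. x < t \<Longrightarrow> t < y \<Longrightarrow> S t \<notin> plateau_values \<Longrightarrow> (G has_real_derivative k t) (at (S t))"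
  shows "(if F \<inter> {x..y} = {} then 0 else INF t\<in>F \<inter> {x..y}. k t) * (S y - S x) \<le> G (S y) - G (S x)"
    and "G (S y) - G (S x) \<le> (if F \<inter> {x..y} = {} then 0 else SUP t\<in>F \<inter> {x..y}. k t) * (S y - S x)"
proof -
  \<comment> \<open>Off the plateaus, every intermediate value is taken at a point of
    \<open>F\<close> inside the piece. There the derivative of \<open>G\<close> is a value of
    \<open>k\<close> over \<open>F\<close>, so it lies between the infimum and the supremum used in
    the Darboux sums.\<close>
  have point: "\<exists>t\<in>F \<inter> {x..y}. (G has_real_derivative k t) (at u)"
    if u: "S x < u" "u < S y" "u \<notin> plateau_values" for u
  proof -
    obtain t where t: "t \<in> F" "x \<le> t" "t < y" "S t = u"
      using value_attained_in_F[of x u y] u by auto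
    moreover have "x < t"
      using S_lessD[of x t] t u by simp
    ultimately show ?thesis
      using deriv[of t] u by auto
  qed
  have *: "(if F \<inter> {x..y} = {} then 0 else INF t\<in>F \<inter> {x..y}. k t) * (S y - S x) \<le> G (S y) - G (S x) \<and>
    G (S y) - G (S x) \<le> (if F \<inter> {x..y} = {} then 0 else SUP t\<in>F \<inter> {x..y}. k t) * (S y - S x)"
  proof (cases "F \<inter> {x..y} = {}")
    case True
    then show ?thesis
      using flat_S[OF assms(2)] by simp
  next
    case False
    have "(INF t\<in>F \<inter> {x..y}. k t) * (S y - S x) \<le> G (S y) - G (S x)"
    proof (rule increment_ge_countable[OF S_le[OF assms(2)] assms(3) countable_plateau_values])
      fix u assume "S x < u" "u < S y" "u \<notin> plateau_values"
      then obtain t where "t \<in> F \<inter> {x..y}" "(G has_real_derivative k t) (at u)"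
        using point by blast
      then show "\<exists>D\<ge>INF t\<in>F \<inter> {x..y}. k t. (G has_real_derivative D) (at u)"
        using bounded_imp_bdd_below[OF bdd] by (intro exI[of _ "k t"]) (auto intro: cINF_lower)
    qed
    moreover have "G (S y) - G (S x) \<le> (SUP t\<in>F \<inter> {x..y}. k t) * (S y - S x)"
    proof (rule increment_le_countable[OF S_le[OF assms(2)] assms(3) countable_plateau_values])
      fix u assume "S x < u" "u < S y" "u \<notin> plateau_values"
      then obtain t where "t \<in> F \<inter> {x..y}" "(G has_real_derivative k t) (at u)"
        using point by blast
      then show "\<exists>D\<le>SUP t\<in>F \<inter> {x..y}. k t. (G has_real_derivative D) (at u)"
        using bounded_imp_bdd_above[OF bdd] by (intro exI[of _ "k t"]) (auto intro: cSUP_upper)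
    qed
    ultimately show ?thesis
      using False by simp
  qed
  from * show "(if F \<inter> {x..y} = {} then 0 else INF t\<in>F \<inter> {x..y}. k t) * (S y - S x) \<le> G (S y) - G (S x)"
    by blast
  from * show "G (S y) - G (S x) \<le> (if F \<inter> {x..y} = {} then 0 else SUP t\<in>F \<inter> {x..y}. k t) * (S y - S x)"
    by blast
qed

lemma darboux_sums_bounds:
  assumes sub: "subdivision 0 b n x"
    and "continuous_on {0..S b} G" "bounded (k ` (F \<inter> {0..b}))"
    and deriv: "\<And>t. 0 < t \<Longrightarrow> t < b \<Longrightarrow> S t \<notin> plateau_values \<Longrightarrow> (G has_real_derivative k t) (at (S t))"
  shows "lower_sum F S k n x \<le> G (S b) - G 0" "G (S b) - G 0 \<le> upper_sum F S k n x"
proof -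
  have tele: "G (S b) - G 0 = (\<Sum>i<n. G (S (x (Suc i))) - G (S (x i)))"
    using sub sum_lessThan_telescope[of "\<lambda>i. G (S (x i))" n] by (simp add: subdivision_def S_0)
  have range: "0 \<le> x i" "x i \<le> b" if "i \<le> n" for i
    using subdivision_range[OF sub that] by auto
  have piece: "0 \<le> x i" "x i \<le> x (Suc i)" "continuous_on {S (x i)..S (x (Suc i))} G"
    "bounded (k ` (F \<inter> {x i..x (Suc i)}))"
    "\<And>t. x i < t \<Longrightarrow> t < x (Suc i) \<Longrightarrow> S t \<notin> plateau_values \<Longrightarrow> (G has_real_derivative k t) (at (S t))"
    if "i < n" for i
  proof -
    have r: "0 \<le> x i" "x (Suc i) \<le> b" "x i < x (Suc i)"
      using range[of i] range[of "Suc i"] that sub by (auto simp: subdivision_def)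
    then show "0 \<le> x i" "x i \<le> x (Suc i)"
      by auto
    show "continuous_on {S (x i)..S (x (Suc i))} G"
      using assms(2) by (rule continuous_on_subset) (use r S_nonneg[of "x i"] S_le[of "x (Suc i)" b] in auto)
    show "bounded (k ` (F \<inter> {x i..x (Suc i)}))"
      using assms(3) by (rule bounded_subset) (use r in auto)
    show "(G has_real_derivative k t) (at (S t))"
      if "x i < t" "t < x (Suc i)" "S t \<notin> plateau_values" for t
      using deriv[of t] that r by simp
  qed
  show "lower_sum F S k n x \<le> G (S b) - G 0"
    unfolding tele lower_sum_def by (intro sum_mono piece_bounds(1) piece) auto
  show "G (S b) - G 0 \<le> upper_sum F S k n x"
    unfolding tele upper_sum_def by (intro sum_mono piece_bounds(2) piece) auto
qed

text \<open>The increment of \<open>G\<close> separates all lower sums from all upper sums. It thus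
  also supplies the bounds without which \<open>Sup\<close> and \<open>Inf\<close> of sets of reals
  would carry no information, and the last two claims rest on this.\<close>

lemma darboux_integrals_bounds:
  assumes "0 \<le> b" "continuous_on {0..S b} G" "bounded (k ` (F \<inter> {0..b}))"
    and deriv: "\<And>t. 0 < t \<Longrightarrow> t < b \<Longrightarrow> S t \<notin> plateau_values \<Longrightarrow> (G has_real_derivative k t) (at (S t))"
  shows "lower_integral F S k 0 b \<le> G (S b) - G 0" "G (S b) - G 0 \<le> upper_integral F S k 0 b"
    and "subdivision 0 b n x \<Longrightarrow> lower_sum F S k n x \<le> lower_integral F S k 0 b"
    and "subdivision 0 b n x \<Longrightarrow> upper_integral F S k 0 b \<le> upper_sum F S k n x"
proof -
  let ?L = "{lower_sum F S k n x | n x. subdivision 0 b n x}"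
  let ?U = "{upper_sum F S k n x | n x. subdivision 0 b n x}"
  obtain n0 x0 where "subdivision 0 b n0 x0"
    using exists_subdivision[OF assms(1) zero_less_one] .
  then have ne: "?L \<noteq> {}" "?U \<noteq> {}"
    by blast+
  have L: "s \<le> G (S b) - G 0" if s: "s \<in> ?L" for s
  proof -
    obtain n x where nx: "s = lower_sum F S k n x" "subdivision 0 b n x"
      using s by blast
    show ?thesis
      unfolding nx(1) by (rule darboux_sums_bounds(1)[OF nx(2) assms(2,3) deriv])
  qed
  have U: "G (S b) - G 0 \<le> s" if s: "s \<in> ?U" for s
  proof -
    obtain n x where nx: "s = upper_sum F S k n x" "subdivision 0 b n x"
      using s by blast
    show ?thesis
      unfolding nx(1) by (rule darboux_sums_bounds(2)[OF nx(2) assms(2,3) deriv])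
  qed
  show "lower_integral F S k 0 b \<le> G (S b) - G 0"
    unfolding lower_integral_def by (rule cSup_least[OF ne(1) L])
  show "G (S b) - G 0 \<le> upper_integral F S k 0 b"
    unfolding upper_integral_def by (rule cInf_greatest[OF ne(2) U])
  show "lower_sum F S k n x \<le> lower_integral F S k 0 b" if "subdivision 0 b n x"
    unfolding lower_integral_def by (rule cSup_upper[OF _ bdd_aboveI[OF L]]) (use that in blast)
  show "upper_integral F S k 0 b \<le> upper_sum F S k n x" if "subdivision 0 b n x"
    unfolding upper_integral_def by (rule cInf_lower[OF _ bdd_belowI[OF U]]) (use that in blast)
qed

text \<open>A fundamental theorem of calculus: integrability squeezes the increment between equal
  upper and lower integrals. The derivative of \<open>G\<close> is required only off the plateau
  values.\<close>

lemma frac_integral_eq_increment: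
  assumes "0 \<le> b" "continuous_on {0..S b} G" "frac_integrable F S k 0 b"
    and "\<And>t. 0 < t \<Longrightarrow> t < b \<Longrightarrow> S t \<notin> plateau_values \<Longrightarrow> (G has_real_derivative k t) (at (S t))"
  shows "frac_integral F S k 0 b = G (S b) - G 0"
proof -
  have "bounded (k ` (F \<inter> {0..b}))"
    using assms(3) by (simp add: frac_integrable_def)
  from darboux_integrals_bounds(1,2)[OF assms(1,2) this assms(4)] assms(3)
  show ?thesis
    by (simp add: frac_integrable_def frac_integral_def)
qed

text \<open>The indefinite integral of \<open>\<phi>\<close> serves as the primitive that separates
  lower from upper sums; uniform continuity of \<open>h\<close> makes their gap arbitrarily
  small.\<close>

lemma frac_integral_continuous:
  assumes b: "0 \<le> b" and \<phi>: "continuous_on {0..S b} \<phi>" and h: "\<And>t. 0 \<le> t \<Longrightarrow> t \<le> b \<Longrightarrow> h t = \<phi> (S t)"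
  shows "frac_integrable F S h 0 b" "frac_integral F S h 0 b = integral {0..S b} \<phi>"
proof -
  have contS: "continuous_on A S" for A
    using cont_S continuous_on_subset by blast
  have "S ` {0..b} \<subseteq> {0..S b}"
    using S_nonneg S_le by auto
  then have "continuous_on {0..b} (\<lambda>t. \<phi> (S t))"
    using continuous_on_compose2[OF \<phi> contS] by blast
  then have cont_h: "continuous_on {0..b} h"
    by (rule continuous_on_eq) (use h in auto)
  have "bounded (h ` {0..b})"
    using compact_continuous_image[OF cont_h] compact_imp_bounded by blast
  then have bdd: "bounded (h ` (F \<inter> {0..b}))"
    by (rule bounded_subset) auto
  define J where "J = integral {0..S b} \<phi>"
  have contG: "continuous_on {0..S b} (\<lambda>u. integral {0..u} \<phi>)"
    using \<phi> by (intro indefinite_integral_continuous_1 integrable_continuous_real)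
  have derivG: "((\<lambda>u. integral {0..u} \<phi>) has_real_derivative h t) (at (S t))"
    if "0 < t" "t < b" "S t \<notin> plateau_values" for t
    using that S_less[of 0 t] S_less[of t b] h[of t] DERIV_integral_at[OF \<phi>, of "S t"] by (simp add: S_0)
  note D = darboux_integrals_bounds[OF b contG bdd derivG]
  have J: "lower_integral F S h 0 b \<le> J" "J \<le> upper_integral F S h 0 b"
    using D(1,2) by (auto simp: J_def)
  have approx: "upper_integral F S h 0 b \<le> lower_integral F S h 0 b + e * S b" if e: "0 < e" for e
  proof -
    obtain d where d: "0 < d" "\<And>s t. s \<in> {0..b} \<Longrightarrow> t \<in> {0..b} \<Longrightarrow> dist t s < d \<Longrightarrow> dist (h t) (h s) < e"
      using compact_uniformly_continuous[OF cont_h compact_Icc] e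
      unfolding uniformly_continuous_on_def by blast
    \<comment> \<open>Halving \<open>d\<close> turns the non-strict mesh bound into the strict
      distance bound of uniform continuity.\<close>
    obtain n x where sub: "subdivision 0 b n x" and mesh: "\<forall>i<n. x (Suc i) - x i \<le> d / 2"
      using exists_subdivision[OF b half_gt_zero[OF d(1)]] .
    have "upper_sum F S h n x - lower_sum F S h n x \<le> (\<Sum>i<n. e * (S (x (Suc i)) - S (x i)))"
      unfolding upper_sum_def lower_sum_def sum_subtractf[symmetric] left_diff_distrib[symmetric]
    proof (rule sum_mono)
      fix i assume "i \<in> {..<n}"
      then have i: "i < n" by simp
      let ?K = "F \<inter> {x i..x (Suc i)}"
      have r: "0 \<le> x i" "x (Suc i) \<le> b" "x i < x (Suc i)"
        using subdivision_range[OF sub, of i] subdivision_range[OF sub, of "Suc i"] i sub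
        by (auto simp: subdivision_def)
      have "(SUP t\<in>?K. h t) \<le> (INF t\<in>?K. h t) + e" if ne: "?K \<noteq> {}"
      proof (rule cSUP_least[OF ne])
        fix t assume t: "t \<in> ?K"
        have "h t - e \<le> h s" if s: "s \<in> ?K" for s
        proof -
          have "x (Suc i) - x i \<le> d / 2"
            using mesh i by simp
          moreover have "x i \<le> s" "s \<le> x (Suc i)" "x i \<le> t" "t \<le> x (Suc i)"
            using s t by auto
          ultimately have "\<bar>t - s\<bar> \<le> d / 2"
            by linarith
          then have "dist t s < d"
            using d(1) by (simp add: dist_real_def)
          then have "dist (h t) (h s) < e"
            using s t r by (intro d(2)) auto
          then show ?thesis
            unfolding dist_real_def by linarith
        qed
        then have "h t - e \<le> (INF s\<in>?K. h s)"
          by (intro cINF_greatest[OF ne]) auto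
        then show "h t \<le> (INF s\<in>?K. h s) + e" by simp
      qed
      then have "(if ?K = {} then 0 else SUP t\<in>?K. h t) - (if ?K = {} then 0 else INF t\<in>?K. h t) \<le> e"
        using \<open>0 < e\<close> by (cases "?K = {}") auto
      then show "((if ?K = {} then 0 else SUP t\<in>?K. h t) - (if ?K = {} then 0 else INF t\<in>?K. h t))
          * (S (x (Suc i)) - S (x i)) \<le> e * (S (x (Suc i)) - S (x i))"
        using S_le[of "x i" "x (Suc i)"] r by (intro mult_right_mono) auto
    qed
    also have "\<dots> = e * S b"
      using sub sum_lessThan_telescope[of "\<lambda>i. S (x i)" n]
      by (simp add: sum_distrib_left[symmetric] subdivision_def S_0)
    finally have "upper_sum F S h n x - lower_sum F S h n x \<le> e * S b" .
    moreover have "lower_sum F S h n x \<le> lower_integral F S h 0 b"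
      using sub by (intro D(3))
    moreover have "upper_integral F S h 0 b \<le> upper_sum F S h n x"
      using sub by (intro D(4))
    ultimately show ?thesis by linarith
  qed
  have "upper_integral F S h 0 b \<le> lower_integral F S h 0 b"
  proof (rule field_le_epsilon)
    fix e :: real assume "0 < e"
    \<comment> \<open>The summand 1 in the denominator covers the case
      \<open>S b = 0\<close>.\<close>
    have "upper_integral F S h 0 b \<le> lower_integral F S h 0 b + e / (S b + 1) * S b"
      using \<open>0 < e\<close> S_nonneg[OF b] by (intro approx) auto
    also have "e / (S b + 1) * S b \<le> e"
      using \<open>0 < e\<close> S_nonneg[OF b] by (simp add: field_simps)
    finally show "upper_integral F S h 0 b \<le> lower_integral F S h 0 b + e" by simp
  qed
  with J have "upper_integral F S h 0 b = J" "lower_integral F S h 0 b = J"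
    by auto
  then show "frac_integrable F S h 0 b" "frac_integral F S h 0 b = integral {0..S b} \<phi>"
    using bdd by (auto simp: frac_integrable_def frac_integral_def J_def)
qed

section \<open>Improper integrals\<close>

lemma tendsto_compose_S_iff: "((\<lambda>b. \<Phi> (S b)) \<longlongrightarrow> I) at_top \<longleftrightarrow> (\<Phi> \<longlongrightarrow> I) at_top"
proof
  assume lim: "((\<lambda>b. \<Phi> (S b)) \<longlongrightarrow> I) at_top"
  show "(\<Phi> \<longlongrightarrow> I) at_top"
  proof (rule topological_tendstoI)
    fix A assume "open A" "I \<in> A"
    then have "\<forall>\<^sub>F b in at_top. \<Phi> (S b) \<in> A"
      using lim topological_tendstoD by blast
    then obtain B where B: "\<And>b. B \<le> b \<Longrightarrow> \<Phi> (S b) \<in> A"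
      by (auto simp: eventually_at_top_linorder)
    \<comment> \<open>Since \<open>S\<close> is continuous and unbounded, every value from
      \<open>S B\<close> on is taken at some point beyond \<open>B\<close>, so the behaviour of
      \<open>\<Phi>\<close> along \<open>S\<close> controls all large arguments.\<close>
    have "\<Phi> U \<in> A" if U: "S B \<le> U" for U
    proof -
      have "\<forall>\<^sub>F b in at_top. B \<le> b \<and> U \<le> S b"
        using S_at_top by (intro eventually_conj eventually_ge_at_top) (simp add: filterlim_at_top)
      then obtain c where "B \<le> c" "U \<le> S c"
        using eventually_happens'[OF trivial_limit_at_top_linorder] by blast
      then obtain b where "B \<le> b" "S b = U"
        using IVT'[of S B U c] U continuous_on_subset[OF cont_S] by auto
      then show ?thesis
        using B by blast
    qed
    then show "\<forall>\<^sub>F U in at_top. \<Phi> U \<in> A"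
      by (auto simp: eventually_at_top_linorder)
  qed
qed (rule filterlim_compose[OF _ S_at_top])

lemma frac_integral_inf_continuous:
  assumes \<phi>: "\<And>U. continuous_on {0..U} \<phi>" and h: "\<And>t. 0 \<le> t \<Longrightarrow> h t = \<phi> (S t)"
  shows "frac_integrable_inf F S h 0 \<longleftrightarrow> (\<exists>I. ((\<lambda>U. integral {0..U} \<phi>) \<longlongrightarrow> I) at_top)"
    and "((\<lambda>U. integral {0..U} \<phi>) \<longlongrightarrow> I) at_top \<Longrightarrow> frac_integral_inf F S h 0 = I"
proof -
  have fin: "frac_integrable F S h 0 b" "frac_integral F S h 0 b = integral {0..S b} \<phi>" if "0 \<le> b" for b
    using frac_integral_continuous[OF that \<phi>] h by auto
  have "\<forall>\<^sub>F b in at_top. frac_integral F S h 0 b = integral {0..S b} \<phi>"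
    using eventually_ge_at_top[of 0] by eventually_elim (rule fin(2))
  then have lim: "((\<lambda>b. frac_integral F S h 0 b) \<longlongrightarrow> I) at_top \<longleftrightarrow> ((\<lambda>U. integral {0..U} \<phi>) \<longlongrightarrow> I) at_top" for I
    unfolding tendsto_compose_S_iff[of "\<lambda>U. integral {0..U} \<phi>" I, symmetric] by (rule tendsto_cong)
  show "frac_integrable_inf F S h 0 \<longleftrightarrow> (\<exists>I. ((\<lambda>U. integral {0..U} \<phi>) \<longlongrightarrow> I) at_top)"
    using fin(1) by (simp add: frac_integrable_inf_def lim)
  show "frac_integral_inf F S h 0 = I" if "((\<lambda>U. integral {0..U} \<phi>) \<longlongrightarrow> I) at_top"
    unfolding frac_integral_inf_def using that by (intro tendsto_Lim) (auto simp: lim)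
qed

end

section \<open>Regularity of \<open>f\<close> deduced from that of \<open>f (S t)\<close>\<close>

context closed_integrator
begin

text \<open>Off the plateaus \<open>t\<close> is the only preimage of \<open>S t\<close>. As this
  value is attained in \<open>F\<close>, \<open>t\<close> itself lies in \<open>F\<close>. All
  values near \<open>S t\<close> are attained at points of \<open>F\<close> near \<open>t\<close>,
  so the limit along \<open>F\<close> becomes an ordinary derivative.\<close>

lemma has_real_derivative_outside_plateaus:
  assumes h: "(\<lambda>s. f (S s)) \<in> frac_C F S 0 (t + 1)"
    and t: "0 < t" "S t \<notin> plateau_values"
  shows "(f has_real_derivative frac_deriv F S {0..} (\<lambda>s. f (S s)) t) (at (S t))"
proof -
  let ?q = "\<lambda>y. (f (S y) - f (S t)) / (S y - S t)"
  have less: "S x < S t" if "x < t" for x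
    using S_less that t by blast
  have greater: "S t < S y" if "t < y" for y
    using S_less that t by blast
  have "S t < S (t + 1)"
    by (rule greater) simp
  then obtain t' where "t' \<in> F" "S t' = S t"
    using value_attained_in_F[of t "S t" "t + 1"] by auto
  with less greater have tF: "t \<in> F"
    by (metis less_irrefl linorder_neqE_linordered_idom)
  with h t obtain L where L: "(?q \<longlongrightarrow> L) (at t within F \<inter> {0..t + 1})"
    unfolding frac_C_def by fastforce
  \<comment> \<open>\<open>frac_C\<close> speaks of a bounded interval and \<open>frac_deriv\<close>
    of the half-line; the room to the right of \<open>t\<close> makes the two limits agree.\<close>
  have same: "at t within F \<inter> {0..t + 1} = at t within F \<inter> {0..}"
    by (rule at_within_nhd[of _ "{..<t + 1}"]) auto
  \<comment> \<open>Only at a limit point is the value of \<open>Lim\<close> determined by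
    convergence.\<close>
  have "t islimpt (F \<inter> {0..})"
    unfolding islimpt_approachable
  proof (intro allI impI)
    fix e :: real assume "0 < e"
    then have lt: "S t < S (t + e)"
      by (intro greater) simp
    then obtain z where z: "S t < z" "z < S (t + e)"
      using dense by blast
    then obtain y where y: "y \<in> F" "t \<le> y" "y < t + e" "S y = z"
      using value_attained_in_F[of t z "t + e"] by auto
    with z t show "\<exists>y\<in>F \<inter> {0..}. y \<noteq> t \<and> dist y t < e"
      by (intro bexI[of _ y]) (auto simp: dist_real_def)
  qed
  then have "at t within F \<inter> {0..} \<noteq> bot"
    by (simp add: trivial_limit_within)
  then have D: "frac_deriv F S {0..} (\<lambda>s. f (S s)) t = L"
    unfolding frac_deriv_def using tF L same by (simp add: tendsto_Lim)
  have "((\<lambda>z. (f z - f (S t)) / (z - S t)) \<longlongrightarrow> L) (at (S t))"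
    unfolding Lim_at
  proof (intro allI impI)
    fix e :: real assume "0 < e"
    then obtain d where d: "0 < d"
      "\<And>y. y \<in> F \<inter> {0..t + 1} \<Longrightarrow> 0 < dist y t \<Longrightarrow> dist y t < d \<Longrightarrow> dist (?q y) L < e"
      using L unfolding Lim_within by metis
    \<comment> \<open>The three bounds place points within \<open>r\<close> of \<open>t\<close>
      closer than \<open>d\<close>, at nonnegative times and below \<open>t + 1\<close>.\<close>
    define r where "r = min (d / 2) (min t 1)"
    have r: "0 < r" "r < d" "r \<le> t" "r \<le> 1"
      using d(1) t by (auto simp: r_def)
    \<comment> \<open>Within \<open>d'\<close> of \<open>S t\<close> a value lies between
      \<open>S (t - r)\<close> and \<open>S (t + r)\<close>, hence has a preimage in
      \<open>F\<close> within \<open>r\<close> of \<open>t\<close>.\<close>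
    define d' where "d' = min (S t - S (t - r)) (S (t + r) - S t)"
    have "0 < d'"
      using less[of "t - r"] greater[of "t + r"] r by (simp add: d'_def)
    moreover have "dist ((f z - f (S t)) / (z - S t)) L < e" if z: "0 < dist z (S t)" "dist z (S t) < d'" for z
    proof -
      have "S (t - r) < z" "z < S (t + r)"
        using z by (auto simp: d'_def dist_real_def)
      then obtain y where y: "y \<in> F" "t - r \<le> y" "y < t + r" "S y = z"
        using value_attained_in_F[of "t - r" z "t + r"] by auto
      have "y \<noteq> t"
        using y z by auto
      then have "dist (?q y) L < e"
        using y r by (intro d(2)) (auto simp: dist_real_def)
      then show ?thesis
        using y by simp
    qed
    ultimately show "\<exists>d>0. \<forall>z. 0 < dist z (S t) \<and> dist z (S t) < d \<longrightarrow>
        dist ((f z - f (S t)) / (z - S t)) L < e"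
      by blast
  qed
  then show ?thesis
    unfolding D has_field_derivative_iff .
qed

text \<open>The quotient \<open>0 / 0 = 0\<close> does no harm here, since \<open>S y = S x\<close> implies
  \<open>f (S y) = f (S x)\<close>.\<close>

lemma continuous_on_frac_C:
  assumes "(\<lambda>s. f (S s)) \<in> frac_C F S 0 b"
  shows "continuous_on (F \<inter> {0..b}) (\<lambda>s. f (S s))"
  unfolding continuous_on_def
proof
  fix x assume x: "x \<in> F \<inter> {0..b}"
  let ?q = "\<lambda>y. (f (S y) - f (S x)) / (S y - S x)"
  obtain L where "(?q \<longlongrightarrow> L) (at x within F \<inter> {0..b})"
    using assms x unfolding frac_C_def by blast
  moreover have "(S \<longlongrightarrow> S x) (at x within F \<inter> {0..b})"
    using continuous_on_subset[OF cont_S, of "F \<inter> {0..b}"] x by (auto simp: continuous_on_def)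
  ultimately have "((\<lambda>y. f (S x) + ?q y * (S y - S x)) \<longlongrightarrow> f (S x) + L * (S x - S x)) (at x within F \<inter> {0..b})"
    by (intro tendsto_intros)
  moreover have "f (S x) + ?q y * (S y - S x) = f (S y)" for y
    by (cases "S y = S x") auto
  ultimately show "((\<lambda>s. f (S s)) \<longlongrightarrow> f (S x)) (at x within F \<inter> {0..b})"
    by simp
qed

text \<open>Because \<open>F\<close> is closed, \<open>F\<close> meets \<open>{0..b}\<close> in a
  compact set. Its image under \<open>S\<close> contains \<open>{0..U}\<close> once
  \<open>S b\<close> exceeds \<open>U\<close>, so the quotient argument applies.\<close>

lemma continuous_on_of_frac_C:
  assumes "\<And>b. 0 < b \<Longrightarrow> (\<lambda>s. f (S s)) \<in> frac_C F S 0 b"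
  shows "continuous_on {0..U} f"
proof -
  have "\<forall>\<^sub>F b in at_top. 0 < b \<and> U < S b"
    using S_at_top by (intro eventually_conj eventually_gt_at_top) (simp add: filterlim_at_top_dense)
  then obtain b where b: "0 < b" "U < S b"
    using eventually_happens'[OF trivial_limit_at_top_linorder] by blast
  have "continuous_on (S ` (F \<inter> {0..b})) f"
  proof (rule continuous_on_compact_quotient)
    show "compact (F \<inter> {0..b})"
      by (rule closed_Int_compact[OF closed_F compact_Icc])
    show "continuous_on (F \<inter> {0..b}) S"
      using cont_S by (rule continuous_on_subset) simp
  qed (rule continuous_on_frac_C[OF assms[OF b(1)]])
  moreover have "{0..U} \<subseteq> S ` (F \<inter> {0..b})"
  proof
    fix u assume "u \<in> {0..U}"
    then have "S 0 \<le> u" "u < S b"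
      using b S_0 by auto
    then obtain t where "t \<in> F" "0 \<le> t" "t < b" "S t = u"
      by (rule value_attained_in_F)
    then show "u \<in> S ` (F \<inter> {0..b})"
      by auto
  qed
  ultimately show ?thesis
    by (rule continuous_on_subset)
qed

end

section \<open>The relaxation equation and the transforms\<close>

text \<open>The solution of \<open>y' = c (f - y)\<close>, \<open>y 0 = f 0\<close>, by variation of constants.\<close>

definition relaxation :: "real \<Rightarrow> (real \<Rightarrow> real) \<Rightarrow> real \<Rightarrow> real" where
  "relaxation c f u = exp (- (c * u)) * f 0
     + c * (exp (- (c * u)) * integral {0..u} (\<lambda>r. exp (c * r) * f r))"

lemma continuous_on_relaxation:
  assumes "\<And>U. continuous_on {0..U} f"
  shows "continuous_on {0..U} (relaxation c f)"
  unfolding relaxation_def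
  by (intro continuous_intros indefinite_integral_continuous_1 integrable_continuous_real assms)

context closed_integrator
begin

text \<open>Integration by parts turns \<open>\<integral> e\<^sup>c\<^sup>u f'(u) du\<close> into an expression without derivatives.\<close>

lemma wsk_deriv_eq:
  assumes "\<And>b. 0 < b \<Longrightarrow> (\<lambda>s. f (S s)) \<in> frac_C F S 0 b"
    and "wsk_exists F S \<gamma> 0 f t" and "0 \<le> t"
  shows "wsk_deriv F S N \<gamma> 0 f t
    = N \<gamma> / (1 - \<gamma>) * (f (S t) - relaxation (\<gamma> / (1 - \<gamma>)) f (S t))"
proof -
  define c where "c = \<gamma> / (1 - \<gamma>)"
  have cont: "continuous_on {0..U} f" for U
    using continuous_on_of_frac_C[OF assms(1)] by blast
  have cont': "continuous_on {0..U} (\<lambda>r. exp (c * r) * f r)" for U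
    by (intro continuous_intros cont)
  \<comment> \<open>The derivative of the integral term cancels the product-rule term
    \<open>c * exp (c * u) * f u\<close>, leaving the integrand; \<open>t\<close> is fixed, so the
    outer factor is a constant.\<close>
  define G where "G u = exp (- (c * S t)) * (exp (c * u) * f u
     - c * integral {0..u} (\<lambda>r. exp (c * r) * f r))" for u
  have "frac_integral F S (wsk_integrand F S \<gamma> 0 f t) 0 t = G (S t) - G 0"
  proof (rule frac_integral_eq_increment[OF assms(3)])
    show "continuous_on {0..S t} G"
      unfolding G_def
      by (intro continuous_intros indefinite_integral_continuous_1 integrable_continuous_real cont)
    show "frac_integrable F S (wsk_integrand F S \<gamma> 0 f t) 0 t"
      using assms(2) by (simp add: wsk_exists_def)
    fix \<tau> assume \<tau>: "0 < \<tau>" "\<tau> < t" "S \<tau> \<notin> plateau_values"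
    define D where "D = frac_deriv F S {0..} (\<lambda>s. f (S s)) \<tau>"
    have Df: "(f has_real_derivative D) (at (S \<tau>))"
      unfolding D_def using \<tau> assms(1) by (intro has_real_derivative_outside_plateaus) auto
    have "0 < S \<tau>"
      using S_less[of 0 \<tau>] \<tau> by (simp add: S_0)
    then have "((\<lambda>u. integral {0..u} (\<lambda>r. exp (c * r) * f r)) has_real_derivative exp (c * S \<tau>) * f (S \<tau>)) (at (S \<tau>))"
      by (intro DERIV_integral_at[OF cont', of _ "S \<tau> + 1"]) auto
    then have "(G has_real_derivative exp (- (c * S t)) * (exp (c * S \<tau>) * D)) (at (S \<tau>))"
      unfolding G_def by (auto intro!: derivative_eq_intros Df simp: algebra_simps)
    also have "exp (- (c * S t)) * (exp (c * S \<tau>) * D) = wsk_integrand F S \<gamma> 0 f t \<tau>"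
      unfolding wsk_integrand_def D_def mult.assoc[symmetric] exp_add[symmetric]
      by (simp add: c_def diff_divide_distrib algebra_simps)
    finally show "(G has_real_derivative wsk_integrand F S \<gamma> 0 f t \<tau>) (at (S \<tau>))" .
  qed
  moreover have "exp (- (c * S t)) * exp (c * S t) = 1"
    by (simp add: exp_add[symmetric])
  then have "G (S t) - G 0 = f (S t) - relaxation c f (S t)"
    unfolding G_def relaxation_def by (simp add: algebra_simps)
  ultimately show ?thesis
    by (simp add: wsk_deriv_def c_def)
qed

end

text \<open>With \<open>E u = e\<^sup>-\<^sup>s\<^sup>u relaxation c f u\<close> one has \<open>E' = - (s + c) E + c e\<^sup>-\<^sup>s\<^sup>u f\<close>, which
  determines the integral of \<open>E\<close> up to the boundary term \<open>E U\<close>.\<close>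

lemma integral_exp_relaxation:
  fixes f :: "real \<Rightarrow> real"
  assumes f: "\<And>U. continuous_on {0..U} f" and "0 \<le> U"
  shows "(s + c) * integral {0..U} (\<lambda>u. exp (- (s * u)) * relaxation c f u)
    = f 0 + c * integral {0..U} (\<lambda>u. exp (- (s * u)) * f u) - exp (- (s * U)) * relaxation c f U"
proof -
  let ?E = "\<lambda>u. exp (- (s * u)) * relaxation c f u"
  let ?g = "\<lambda>u. exp (- (s * u)) * f u"
  have contE: "continuous_on {0..U} ?E"
    by (intro continuous_intros continuous_on_relaxation f)
  have contg: "continuous_on {0..U} ?g"
    by (intro continuous_intros f)
  have "((\<lambda>u. c * ?g u - (s + c) * ?E u) has_integral ?E U - ?E 0) {0..U}"
  proof (rule fundamental_theorem_of_calculus_interior[OF assms(2) contE])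
    fix u assume "u \<in> {0<..<U}"
    then have "((\<lambda>u. integral {0..u} (\<lambda>r. exp (c * r) * f r)) has_real_derivative exp (c * u) * f u) (at u)"
      by (intro DERIV_integral_at[of 0 U] continuous_intros f) auto
    then have "(?E has_real_derivative c * (exp (- (s * u)) * (exp (- (c * u)) * exp (c * u)) * f u) - (s + c) * ?E u) (at u)"
      unfolding relaxation_def by (auto intro!: derivative_eq_intros simp: algebra_simps)
    moreover have "exp (- (c * u)) * exp (c * u) = 1"
      by (simp add: exp_add[symmetric])
    ultimately show "(?E has_vector_derivative c * ?g u - (s + c) * ?E u) (at u)"
      by (simp add: has_real_derivative_iff_has_vector_derivative)
  qed
  moreover have "((\<lambda>u. c * ?g u - (s + c) * ?E u) has_integral
      c * integral {0..U} ?g - (s + c) * integral {0..U} ?E) {0..U}"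
    using contE contg
    by (intro has_integral_diff has_integral_mult_right integrable_integral integrable_continuous_real)
  ultimately have "?E U - ?E 0 = c * integral {0..U} ?g - (s + c) * integral {0..U} ?E"
    by (rule has_integral_unique)
  then show ?thesis
    by (simp add: relaxation_def)
qed

text \<open>For \<open>s + c \<le> 0\<close> the boundary term need not tend to 0 on its own. But if the integral \<open>Y\<close> of \<open>E\<close>
  converges, then so does \<open>E\<close>, and its limit is that of \<open>Y U / U\<close>, which is 0.\<close>

lemma laplace_relaxation:
  fixes f :: "real \<Rightarrow> real"
  assumes f: "\<And>U. continuous_on {0..U} f"
    and I: "((\<lambda>U. integral {0..U} (\<lambda>u. exp (- (s * u)) * f u)) \<longlongrightarrow> I) at_top"
  shows "0 < s + c \<Longrightarrow>
      ((\<lambda>U. integral {0..U} (\<lambda>u. exp (- (s * u)) * relaxation c f u)) \<longlongrightarrow> (f 0 + c * I) / (s + c)) at_top"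
    and "((\<lambda>U. integral {0..U} (\<lambda>u. exp (- (s * u)) * relaxation c f u)) \<longlongrightarrow> X) at_top \<Longrightarrow>
      (s + c) * X = f 0 + c * I"
proof -
  define E where "E = (\<lambda>u. exp (- (s * u)) * relaxation c f u)"
  define A where "A U = integral {0..U} (\<lambda>u. exp (- (s * u)) * f u)" for U
  define Y where "Y U = integral {0..U} E" for U
  have eqn: "(s + c) * Y U = f 0 + c * A U - E U" if "0 \<le> U" for U
    using integral_exp_relaxation[OF f that, of s c] by (simp add: E_def A_def Y_def)
  have A: "(A \<longlongrightarrow> I) at_top"
    using I unfolding A_def .
  have DY: "(Y has_real_derivative E U) (at U)" if "0 < U" for U
  proof -
    have "continuous_on {0..U + 1} E"
      unfolding E_def by (intro continuous_intros continuous_on_relaxation f)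
    from DERIV_integral_at[OF this that] show ?thesis
      unfolding Y_def by simp
  qed
  show "((\<lambda>U. integral {0..U} (\<lambda>u. exp (- (s * u)) * relaxation c f u)) \<longlongrightarrow> (f 0 + c * I) / (s + c)) at_top"
    if p: "0 < s + c"
  proof -
    let ?p = "s + c"
    \<comment> \<open>The quotient is \<open>Y\<close> itself. After multiplication by the
      integrating factor the numerator has derivative
      \<open>(E U + ?p * Y U) * exp (?p * U)\<close>, and \<open>eqn\<close> replaces the
      uncontrolled \<open>E\<close> by the convergent \<open>f 0 + c * A U\<close>.\<close>
    have "((\<lambda>U. Y U * exp (?p * U) / exp (?p * U)) \<longlongrightarrow> (f 0 + c * I) / ?p) at_top"
    proof (rule lhospital_at_top_at_top)
      show "LIM U at_top. exp (?p * U) :> at_top"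
        using p by (intro filterlim_compose[OF exp_at_top] filterlim_tendsto_pos_mult_at_top[OF tendsto_const] filterlim_ident)
      show "\<forall>\<^sub>F U in at_top. ?p * exp (?p * U) \<noteq> 0"
        using p by simp
      show "\<forall>\<^sub>F U in at_top. ((\<lambda>U. exp (?p * U)) has_real_derivative ?p * exp (?p * U)) (at U)"
        by (rule always_eventually) (auto intro!: derivative_eq_intros)
      show "\<forall>\<^sub>F U in at_top. ((\<lambda>U. Y U * exp (?p * U)) has_real_derivative (f 0 + c * A U) * exp (?p * U)) (at U)"
        using eventually_gt_at_top[of 0]
      proof eventually_elim
        case (elim U)
        have "((\<lambda>U. Y U * exp (?p * U)) has_real_derivative (E U + ?p * Y U) * exp (?p * U)) (at U)"
          by (rule derivative_eq_intros DY elim refl | simp add: algebra_simps)+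
        then show ?case
          using eqn[of U] elim by simp
      qed
      have "((\<lambda>U. (f 0 + c * A U) / ?p) \<longlongrightarrow> (f 0 + c * I) / ?p) at_top"
        using p by (intro tendsto_intros A) auto
      then show "((\<lambda>U. (f 0 + c * A U) * exp (?p * U) / (?p * exp (?p * U))) \<longlongrightarrow> (f 0 + c * I) / ?p) at_top"
        by simp
    qed
    then show ?thesis
      unfolding Y_def E_def by simp
  qed
  show "(s + c) * X = f 0 + c * I"
    if "((\<lambda>U. integral {0..U} (\<lambda>u. exp (- (s * u)) * relaxation c f u)) \<longlongrightarrow> X) at_top"
  proof -
    have Y: "(Y \<longlongrightarrow> X) at_top"
      using that unfolding Y_def E_def .
    have "((\<lambda>U. f 0 + c * A U - (s + c) * Y U) \<longlongrightarrow> f 0 + c * I - (s + c) * X) at_top"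
      by (intro tendsto_intros A Y)
    moreover have "\<forall>\<^sub>F U in at_top. f 0 + c * A U - (s + c) * Y U = E U"
      using eventually_ge_at_top[of 0] by eventually_elim (simp add: eqn)
    ultimately have E: "(E \<longlongrightarrow> f 0 + c * I - (s + c) * X) at_top"
      by (rule Lim_transform_eventually)
    have "((\<lambda>U. Y U / U) \<longlongrightarrow> f 0 + c * I - (s + c) * X) at_top"
    proof (rule lhospital_at_top_at_top)
      show "\<forall>\<^sub>F U in at_top. (Y has_real_derivative E U) (at U)"
        using eventually_gt_at_top[of 0] by eventually_elim (rule DY)
      show "\<forall>\<^sub>F U in at_top. ((\<lambda>U. U) has_real_derivative 1) (at U)"
        by simp
    qed (use E in \<open>auto simp: filterlim_ident\<close>)
    moreover have "((\<lambda>U. Y U / U) \<longlongrightarrow> 0) at_top"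
      by (rule tendsto_divide_0[OF Y filterlim_at_top_imp_at_infinity[OF filterlim_ident]])
    ultimately show ?thesis
      using tendsto_unique[OF trivial_limit_at_top_linorder] by fastforce
  qed
qed

section \<open>The transforms of the wsk-derivative\<close>

context closed_integrator
begin

text \<open>Both transforms are covered by leaving \<open>s\<close> free: \<open>S v\<close> for
  Laplace, \<open>1 / S v\<close> for Sumudu. If \<open>I\<close> and \<open>X\<close> are the
  transforms of \<open>f\<close> and of its relaxation, then
  \<open>(s + c) * X = f 0 + c * I\<close> gives
  \<open>I - X = (s * I - f 0) / (s + c)\<close>.\<close>

lemma transform_of_relaxation_difference:
  assumes f: "\<And>U. continuous_on {0..U} f"
    and W: "\<And>t. 0 \<le> t \<Longrightarrow> W t = K * (f (S t) - relaxation c f (S t))"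
    and ex: "frac_integrable_inf F S (\<lambda>t. exp (- (s * S t)) * f (S t)) 0"
  shows "0 < s + c \<Longrightarrow> frac_integrable_inf F S (\<lambda>t. exp (- (s * S t)) * W t) 0"
    and "s + c \<noteq> 0 \<Longrightarrow> frac_integrable_inf F S (\<lambda>t. exp (- (s * S t)) * W t) 0 \<Longrightarrow>
      frac_integral_inf F S (\<lambda>t. exp (- (s * S t)) * W t) 0
        = K * ((s * frac_integral_inf F S (\<lambda>t. exp (- (s * S t)) * f (S t)) 0 - f 0) / (s + c))"
proof -
  let ?g = "\<lambda>u. exp (- (s * u)) * f u"
  let ?E = "\<lambda>u. exp (- (s * u)) * relaxation c f u"
  let ?w = "\<lambda>u. exp (- (s * u)) * (K * (f u - relaxation c f u))"
  have contg: "continuous_on {0..U} ?g" for U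
    by (intro continuous_intros f)
  have contE: "continuous_on {0..U} ?E" for U
    by (intro continuous_intros continuous_on_relaxation f)
  have contw: "continuous_on {0..U} ?w" for U
    by (intro continuous_intros continuous_on_relaxation f)
  note g = frac_integral_inf_continuous[where \<phi> = ?g and h = "\<lambda>t. exp (- (s * S t)) * f (S t)", OF contg refl]
  have w: "frac_integrable_inf F S (\<lambda>t. exp (- (s * S t)) * W t) 0 \<longleftrightarrow> (\<exists>I. ((\<lambda>U. integral {0..U} ?w) \<longlongrightarrow> I) at_top)"
    "((\<lambda>U. integral {0..U} ?w) \<longlongrightarrow> I) at_top \<Longrightarrow> frac_integral_inf F S (\<lambda>t. exp (- (s * S t)) * W t) 0 = I" for I
    by (rule frac_integral_inf_continuous[where \<phi> = ?w, OF contw]; simp add: W)+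
  obtain I where I: "((\<lambda>U. integral {0..U} ?g) \<longlongrightarrow> I) at_top"
    using ex g(1) by blast
  then have gI: "frac_integral_inf F S (\<lambda>t. exp (- (s * S t)) * f (S t)) 0 = I"
    by (rule g(2))
  have split: "integral {0..U} ?w = K * (integral {0..U} ?g - integral {0..U} ?E)" for U
  proof -
    have "((\<lambda>u. K * (?g u - ?E u)) has_integral K * (integral {0..U} ?g - integral {0..U} ?E)) {0..U}"
      using contE contg
      by (intro has_integral_diff has_integral_mult_right integrable_integral integrable_continuous_real)
    then show ?thesis
      by (intro integral_unique) (simp add: algebra_simps)
  qed
  note E = laplace_relaxation[OF f I, of c]
  show "frac_integrable_inf F S (\<lambda>t. exp (- (s * S t)) * W t) 0" if "0 < s + c"
    unfolding w(1) split using tendsto_mult[OF tendsto_const tendsto_diff[OF I E(1)[OF that]]] by blast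
  assume sc: "s + c \<noteq> 0" and exw: "frac_integrable_inf F S (\<lambda>t. exp (- (s * S t)) * W t) 0"
  show "frac_integral_inf F S (\<lambda>t. exp (- (s * S t)) * W t) 0
      = K * ((s * frac_integral_inf F S (\<lambda>t. exp (- (s * S t)) * f (S t)) 0 - f 0) / (s + c))"
  \<comment> \<open>Convergence for the relaxation is recovered from that for \<open>W\<close> by
    dividing by \<open>K\<close>. For \<open>K = 0\<close> this is impossible, but both sides are
    then 0.\<close>
  proof (cases "K = 0")
    case True
    then show ?thesis
      using w(2)[of 0] by simp
  next
    case False
    obtain J where J: "((\<lambda>U. integral {0..U} ?w) \<longlongrightarrow> J) at_top"
      using exw w(1) by blast
    have "((\<lambda>U. integral {0..U} ?g - integral {0..U} ?w / K) \<longlongrightarrow> I - J / K) at_top"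
      using False by (intro tendsto_intros I J)
    moreover have "integral {0..U} ?g - integral {0..U} ?w / K = integral {0..U} ?E" for U
      using False by (simp add: split)
    ultimately have "((\<lambda>U. integral {0..U} ?E) \<longlongrightarrow> I - J / K) at_top"
      by simp
    then have "(s + c) * (I - J / K) = f 0 + c * I"
      by (rule E(2))
    then have "J = K * ((s * I - f 0) / (s + c))"
      using False sc by (simp add: field_simps)
    with w(2)[OF J] show ?thesis
      by (simp add: gI)
  qed
qed

end

theorem theorem3p6:
  fixes \<alpha> \<gamma> l :: real and F :: "real set" and N f S :: "real \<Rightarrow> real"
  defines "S \<equiv> staircase \<alpha> F l"
  assumes "0 < \<alpha>" "\<alpha> \<le> 1"
    and "closed F"
    and "\<And>x y. x \<le> y \<Longrightarrow> mass \<alpha> F x y < \<infinity>"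
    and "S 0 = 0"
    and "filterlim S at_top at_top"
    and "0 \<le> \<gamma>" "\<gamma> < 1"
    and "N 0 = 1" "N 1 = 1"
    and "\<And>b. b > 0 \<Longrightarrow> (\<lambda>t. f (S t)) \<in> frac_C F S 0 b"
    and "\<And>t. t \<ge> 0 \<Longrightarrow> wsk_exists F S \<gamma> 0 f t"
  shows "(\<forall>v. laplace_exists F S (\<lambda>t. f (S t)) v \<longrightarrow>
            (S v + \<gamma> / (1 - \<gamma>) > 0 \<longrightarrow> laplace_exists F S (wsk_deriv F S N \<gamma> 0 f) v) \<and>
            (S v + \<gamma> / (1 - \<gamma>) \<noteq> 0 \<and> laplace_exists F S (wsk_deriv F S N \<gamma> 0 f) v \<longrightarrow>
               laplace F S (wsk_deriv F S N \<gamma> 0 f) v =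
                 N \<gamma> / (1 - \<gamma>) *
                   ((S v * laplace F S (\<lambda>t. f (S t)) v - f 0) / (S v + \<gamma> / (1 - \<gamma>)))))
       \<and> (\<forall>v. sumudu_exists F S (\<lambda>t. f (S t)) v \<longrightarrow>
            (1 / S v + \<gamma> / (1 - \<gamma>) > 0 \<longrightarrow> sumudu_exists F S (wsk_deriv F S N \<gamma> 0 f) v) \<and>
            (1 + \<gamma> / (1 - \<gamma>) * S v \<noteq> 0 \<and> sumudu_exists F S (wsk_deriv F S N \<gamma> 0 f) v \<longrightarrow>
               sumudu F S (wsk_deriv F S N \<gamma> 0 f) v =
                 N \<gamma> / (1 - \<gamma>) *
                   ((sumudu F S (\<lambda>t. f (S t)) v - f 0) / (1 + \<gamma> / (1 - \<gamma>) * S v))))"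
proof -
  interpret finite_mass \<alpha> F
    using assms(2,5) by unfold_locales
  interpret closed_integrator F S
  proof
    show "S x = S y" if "x \<le> y" "F \<inter> {x..y} = {}" for x y
      using staircase_diff[OF that(1), of l] rmass_eq_0[OF that] by (simp add: S_def)
  qed (use assms(4,6,7) staircase_mono continuous_staircase in \<open>simp_all add: S_def\<close>)
  define c where "c = \<gamma> / (1 - \<gamma>)"
  let ?W = "wsk_deriv F S N \<gamma> 0 f"
  let ?K = "N \<gamma> / (1 - \<gamma>)"
  have f: "continuous_on {0..U} f" for U
    using continuous_on_of_frac_C[OF assms(12)] .
  have W: "?W t = ?K * (f (S t) - relaxation c f (S t))" if "0 \<le> t" for t
    unfolding c_def using wsk_deriv_eq[OF assms(12) assms(13)[OF that] that] .
  note T = transform_of_relaxation_difference[of f ?W ?K c, OF f W]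
  have laplace: "(S v + c > 0 \<longrightarrow> laplace_exists F S ?W v) \<and>
      (S v + c \<noteq> 0 \<and> laplace_exists F S ?W v \<longrightarrow>
        laplace F S ?W v = ?K * ((S v * laplace F S (\<lambda>t. f (S t)) v - f 0) / (S v + c)))"
    if "laplace_exists F S (\<lambda>t. f (S t)) v" for v
    using T[of "S v", OF _ that[unfolded laplace_exists_def]]
    unfolding laplace_exists_def laplace_def by simp
  have sumudu: "(1 / S v + c > 0 \<longrightarrow> sumudu_exists F S ?W v) \<and>
      (1 + c * S v \<noteq> 0 \<and> sumudu_exists F S ?W v \<longrightarrow>
        sumudu F S ?W v = ?K * ((sumudu F S (\<lambda>t. f (S t)) v - f 0) / (1 + c * S v)))"
    if "sumudu_exists F S (\<lambda>t. f (S t)) v" for v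
  proof -
    have Sv: "S v \<noteq> 0"
      using that by (simp add: sumudu_exists_def)
    have div: "S t / S v = 1 / S v * S t" for t
      by simp
    have nz: "1 / S v + c \<noteq> 0 \<longleftrightarrow> 1 + c * S v \<noteq> 0"
      using Sv by (simp add: field_simps)
    \<comment> \<open>The prefactor \<open>1 / S v\<close> of the Sumudu transform turns the
      denominator \<open>1 / S v + c\<close> into \<open>1 + c * S v\<close>, while in the numerator
      \<open>1 / S v * I\<close> already is the Sumudu transform of \<open>f\<close>.\<close>
    have val: "1 / S v * (?K * ((1 / S v * I - f 0) / (1 / S v + c)))
        = ?K * ((1 / S v * I - f 0) / (1 + c * S v))" for I
    proof -
      have "1 + c * S v = S v * (1 / S v + c)"
        using Sv by (simp add: algebra_simps)
      then show ?thesis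
        by simp
    qed
    have ex: "frac_integrable_inf F S (\<lambda>t. exp (- (1 / S v * S t)) * f (S t)) 0"
      using that by (simp add: sumudu_exists_def)
    show ?thesis
    proof (intro conjI impI)
      show "sumudu_exists F S ?W v" if "1 / S v + c > 0"
        using T(1)[of "1 / S v", OF _ ex that] Sv by (simp add: sumudu_exists_def)
      assume *: "1 + c * S v \<noteq> 0 \<and> sumudu_exists F S ?W v"
      then have "frac_integrable_inf F S (\<lambda>t. exp (- (1 / S v * S t)) * ?W t) 0"
        by (simp add: sumudu_exists_def)
      from T(2)[of "1 / S v", OF _ ex _ this]
      show "sumudu F S ?W v = ?K * ((sumudu F S (\<lambda>t. f (S t)) v - f 0) / (1 + c * S v))"
        using * nz unfolding sumudu_def div by (simp only: val simp_thms)
    qed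
  qed
  show ?thesis
    using laplace sumudu unfolding c_def by blast
qed

end
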